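(* Let $p$ be prime, $a\ge1$, $q=p^a$, $n,d\ge1$. Let $\bar F\in\mathbf F_q[x]_d$ and let $X$ be the hypersurface in $\mathbf T^n_{\mathbf F_q}$ cut out by $\bar F$. Let $r,\lambda,\tau$ be positive integers with $\tau\ge\frac{\lambda}{(p-1)ar}$. Let $F\in\mathbf Z_q[x]_d$ be any lift of $\bar F$. Then $$|X(\mathbf F_{q^r})|\equiv(q^r-1)^n\sum_{s=0}^{\lambda+\tau-1}\alpha_s\operatorname{trace}(A_{F^s}^{ar})\pmod{p^\lambda},$$ where $\alpha_s=(-1)^s\sum_{t=0}^{\tau-1}\binom{-\lambda}{t}\binom{\lambda}{s-t}\in\mathbf Z$, and $A_{F^s}^{ar}$ is regarded as a $\mathbf Z_q$-linear operator on $\mathbf Z_q[x]_{ds}$, with trace taken with respect to the monomial basis $\{x^w:w\in B_{ds}\}$ (for $s=0$, $\mathbf Z_q[x]_0=\mathbf Z_q$).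
   Context: For a ring $R$, $R[x]=R[x_0,\dots,x_n]$; $R[x]_k$ is the module of homogeneous polynomials of degree $k$, with basis $x^u=x_0^{u_0}\cdots x_n^{u_n}$ for $u\in B_k=\{u\in\mathbf N^{n+1}:u_0+\cdots+u_n=k\}$. For $G\in R[x]$ and $u\in\mathbf Z^{n+1}$, $G_u$ is the coefficient of $x^u$ (zero if some $u_i<0$). $\mathbf Z_q$ is the ring of Witt vectors of $\mathbf F_q$ (ring of integers of the unramified extension of $\mathbf Q_p$ of degree $a$), and $\phi:\mathbf Z_q\to\mathbf Z_q$ is the Frobenius automorphism lifting $u\mapsto u^p$ on $\mathbf F_q$. Define $\phi,\psi:\mathbf Z_q[x]\to\mathbf Z_q[x]$ by $\phi(G)=\sum_u\phi(G_u)x^{pu}$ and $\psi(G)=\sum_u\phi^{-1}(G_{pu})x^u$. For homogeneous $H\in\mathbf Z_q[x]$, $A_H=\psi\circ T_{H^{p-1}}$ where $T_{H^{p-1}}$ is multiplication by $H^{p-1}$; $A_H$ is $\phi^{-1}$-semilinear and maps $\mathbf Z_q[x]_k$ to itself for $H$ of degree $k$, so $A_H^{ar}$ is $\mathbf Z_q$-linear. $\mathbf T^n_{\mathbf F_q}=\{x_0\cdots x_n\ne0\}\subset\mathbf P^n_{\mathbf F_q}$ and $|X(\mathbf F_{q^r})|=\frac1{q^r-1}\#\{c\in(\mathbf F_{q^r}^* )^{n+1}:\bar F(c)=0\}$ ($\bar F=0$ allowed). *)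

theory Defs
  imports Complex_Main "HOL-Computational_Algebra.Primes" "HOL-Library.Poly_Mapping" "HOL-Library.FuncSet"
begin

text \<open>Polynomials in the variables x_0,...,x_n over a ring R are represented as
  elements of (nat =>0 nat) =>0 R: an exponent vector u (a finitely supported
  function nat => nat) is mapped to the coefficient of x^u.  Multiplication is
  the library's convolution product.\<close>

type_synonym 'a mpoly = "(nat \<Rightarrow>\<^sub>0 nat) \<Rightarrow>\<^sub>0 'a"

definition Bdeg :: "nat \<Rightarrow> nat \<Rightarrow> (nat \<Rightarrow>\<^sub>0 nat) set" where
  "Bdeg n k = {u. Poly_Mapping.keys u \<subseteq> {..n} \<and> (\<Sum>i\<le>n. Poly_Mapping.lookup u i) = k}"

definition homog :: "nat \<Rightarrow> nat \<Rightarrow> 'a::zero mpoly \<Rightarrow> bool" where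
  "homog n k G \<longleftrightarrow> Poly_Mapping.keys G \<subseteq> Bdeg n k"

definition scale_exp :: "nat \<Rightarrow> (nat \<Rightarrow>\<^sub>0 nat) \<Rightarrow> (nat \<Rightarrow>\<^sub>0 nat)" where
  "scale_exp p u = Poly_Mapping.map (\<lambda>e. p * e) u"

text \<open>psi(G) = sum_u phi^{-1}(G_{pu}) x^u, where phiinv is the inverse Frobenius.\<close>
definition psi_op :: "nat \<Rightarrow> ('a::zero \<Rightarrow> 'a) \<Rightarrow> 'a mpoly \<Rightarrow> 'a mpoly" where
  "psi_op p phiinv G = Abs_poly_mapping (\<lambda>u. phiinv (Poly_Mapping.lookup G (scale_exp p u)))"

definition A_op :: "nat \<Rightarrow> ('a::comm_ring_1 \<Rightarrow> 'a) \<Rightarrow> 'a mpoly \<Rightarrow> 'a mpoly \<Rightarrow> 'a mpoly" where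
  "A_op p phiinv H G = psi_op p phiinv (H ^ (p - 1) * G)"

definition trace_A_pow :: "nat \<Rightarrow> nat \<Rightarrow> ('a::comm_ring_1 \<Rightarrow> 'a) \<Rightarrow> 'a mpoly \<Rightarrow> nat \<Rightarrow> nat \<Rightarrow> 'a" where
  "trace_A_pow n p phiinv H m k =
     (\<Sum>w\<in>Bdeg n k. Poly_Mapping.lookup (((A_op p phiinv H) ^^ m) (Poly_Mapping.single w 1)) w)"

definition eval_mpoly :: "nat \<Rightarrow> ('k::zero \<Rightarrow> 'K::comm_semiring_1) \<Rightarrow> 'k mpoly \<Rightarrow> (nat \<Rightarrow> 'K) \<Rightarrow> 'K" where
  "eval_mpoly n e G c = (\<Sum>u\<in>Poly_Mapping.keys G. e (Poly_Mapping.lookup G u) * (\<Prod>i\<le>n. c i ^ Poly_Mapping.lookup u i))"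

text \<open>|X(F_{q^r})| = (1/(q^r-1)) #{c in (F_{q^r}^*)^{n+1} : Fbar(c) = 0}, where
  F_{q^r} is the finite field 'K of cardinality q^r, containing F_q via e.\<close>
definition torus_point_count :: "nat \<Rightarrow> ('k::zero \<Rightarrow> 'K::{finite,field}) \<Rightarrow> 'k mpoly \<Rightarrow> nat" where
  "torus_point_count n e G =
     card {c \<in> PiE {..n} (\<lambda>_. UNIV - {0::'K}). eval_mpoly n e G c = 0} div (card (UNIV :: 'K set) - 1)"

text \<open>alpha_s = (-1)^s sum_{t<tau} binom(-lambda,t) binom(lambda,s-t), using the
  standard integer formula binom(-lambda,t) = (-1)^t binom(lambda+t-1,t) (lambda >= 1).\<close>
definition alpha_coeff :: "nat \<Rightarrow> nat \<Rightarrow> nat \<Rightarrow> int" where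
  "alpha_coeff lam tau s = (-1) ^ s *
     (\<Sum>t<tau. ((-1) ^ t * int ((lam + t - 1) choose t)) * (if t \<le> s then int (lam choose (s - t)) else 0))"

definition is_ring_hom :: "('a::ring_1 \<Rightarrow> 'b::ring_1) \<Rightarrow> bool" where
  "is_ring_hom f \<longleftrightarrow> f 1 = 1 \<and> (\<forall>x y. f (x + y) = f x + f y) \<and> (\<forall>x y. f (x * y) = f x * f y)"

definition cong_ideal :: "'a::comm_ring_1 \<Rightarrow> 'a \<Rightarrow> 'a \<Rightarrow> bool" where
  "cong_ideal m x y \<longleftrightarrow> (\<exists>z. x - y = m * z)"

text \<open>Characterization of Z_q = W(F_q): a commutative ring W with a surjective
  ring hom red onto F_q (the finite field 'k) whose kernel is pW, in which p is a
  non-zero-divisor, and which is p-adically separated and complete.  Such a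
  ring is (uniquely up to unique isomorphism) the ring of Witt vectors of 'k.\<close>
definition is_witt_ring :: "nat \<Rightarrow> ('w::comm_ring_1 \<Rightarrow> 'k::field) \<Rightarrow> bool" where
  "is_witt_ring p red \<longleftrightarrow>
     is_ring_hom red \<and> surj red \<and>
     (\<forall>x. red x = 0 \<longleftrightarrow> (\<exists>y. x = of_nat p * y)) \<and>
     (\<forall>x::'w. of_nat p * x = 0 \<longrightarrow> x = 0) \<and>
     (\<forall>x::'w. (\<forall>m. cong_ideal (of_nat p ^ m) x 0) \<longrightarrow> x = 0) \<and>
     (\<forall>f :: nat \<Rightarrow> 'w. (\<forall>m. cong_ideal (of_nat p ^ m) (f (Suc m)) (f m)) \<longrightarrow>
         (\<exists>L. \<forall>m. cong_ideal (of_nat p ^ m) (f m) L))"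

definition is_frobenius_lift :: "nat \<Rightarrow> ('w::comm_ring_1 \<Rightarrow> 'k::field) \<Rightarrow> ('w \<Rightarrow> 'w) \<Rightarrow> bool" where
  "is_frobenius_lift p red phi \<longleftrightarrow> is_ring_hom phi \<and> bij phi \<and> (\<forall>x. red (phi x) = red x ^ p)"

end

theory Submission
  imports Defs "HOL-Computational_Algebra.Polynomial"
begin

text \<open>Write \<open>m = ar\<close> and \<open>Q = p\<^sup>m\<close>. Since \<open>H \<cdot> \<psi>(G) = \<psi>(\<phi>(H) \<cdot> G)\<close>, the trace of \<open>A\<^sup>m\<close> for \<open>F\<^sup>s\<close> is the sum of
  the coefficients of the \<open>s(p - 1)\<close>-st power of \<open>\<Prod>\<^sub>i \<phi>\<^sup>i(F)\<close>, \<open>i < m\<close>, at the exponents divisible by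
  \<open>Q - 1\<close>. By orthogonality of characters, \<open>(Q - 1)\<^bsup>n+1\<^esup>\<close> times this sum is the sum of \<open>z\<^sup>s\<close> over all
  Teichmueller points \<open>c\<close> of the torus, where \<open>z\<close> is the \<open>(p - 1)\<close>-st power of the norm of \<open>F(c)\<close>. Now
  \<open>\<Sum>\<^sub>s \<alpha>\<^sub>s z\<^sup>s\<close> is \<open>(1 - z)\<^sup>\<lambda>\<close> times the truncation at \<open>z\<^sup>\<tau>\<close> of \<open>(1 - z)\<^bsup>-\<lambda>\<^esup>\<close>: modulo \<open>p\<^sup>\<lambda>\<close> it is \<open>0\<close> if
  \<open>F(c)\<close> is a unit, as then \<open>z \<equiv> 1\<close> modulo \<open>p\<close>, and \<open>1\<close> if \<open>p\<close> divides \<open>F(c)\<close>, as then \<open>p\<^sup>\<lambda>\<close> divides \<open>z\<^sup>\<tau>\<close>.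

  The unramified extension containing the Teichmueller points is never constructed. It is replaced by
  \<open>W[t]\<close>, where \<open>t\<close> reduces to a primitive element of the big field and congruences are taken modulo
  ideals \<open>J M\<close> that meet the constants \<open>W\<close> in \<open>p\<^sup>M W\<close>.\<close>

section \<open>The trace of the operator\<close>

lemma is_ring_homD:
  assumes "is_ring_hom f"
  shows "f 1 = 1" "f (x + y) = f x + f y" "f (x * y) = f x * f y"
    "f 0 = 0" "f (- x) = - f x" "f (x - y) = f x - f y" "f (x ^ k) = f x ^ k"
    "f (of_nat k) = of_nat k" "f (of_int i) = of_int i"
proof -
  show 1: "f 1 = 1" and add: "\<And>x y. f (x + y) = f x + f y" and mult: "\<And>x y. f (x * y) = f x * f y"
    using assms by (auto simp: is_ring_hom_def)
  show 0: "f 0 = 0" using add[of 0 0] by simp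
  show um: "f (- x) = - f x" for x using add[of x "- x"] 0
    by (simp add: add_eq_0_iff)
  show "f (x - y) = f x - f y" using add[of x "- y"] um by simp
  show "f (x ^ k) = f x ^ k" by (induction k) (auto simp: 1 mult)
  show nat: "f (of_nat k) = of_nat k" for k by (induction k) (auto simp: 1 0 add)
  show "f (of_int i) = of_int i"
  proof (cases i)
    case (neg k)
    then have "of_int i = (- of_nat (Suc k) :: 'a)" "of_int i = (- of_nat (Suc k) :: 'b)" by auto
    then show ?thesis by (simp only: um nat)
  qed (simp add: nat)
qed

lemma is_ring_hom_sum: "is_ring_hom f \<Longrightarrow> f (sum g A) = (\<Sum>x\<in>A. f (g x))"
  by (induction A rule: infinite_finite_induct) (auto simp: is_ring_homD)

lemma is_ring_hom_prod:
  fixes f :: "'a::comm_ring_1 \<Rightarrow> 'b::comm_ring_1"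
  shows "is_ring_hom f \<Longrightarrow> f (prod g A) = (\<Prod>x\<in>A. f (g x))"
  by (induction A rule: infinite_finite_induct) (auto simp: is_ring_homD)

lemma is_ring_hom_comp: "is_ring_hom f \<Longrightarrow> is_ring_hom g \<Longrightarrow> is_ring_hom (\<lambda>x. f (g x))"
  by (simp add: is_ring_hom_def)

lemma is_ring_hom_funpow:
  fixes f :: "'a::ring_1 \<Rightarrow> 'a"
  shows "is_ring_hom f \<Longrightarrow> is_ring_hom (f ^^ k)"
  by (induction k) (auto simp: is_ring_hom_def)

lemma is_ring_hom_inv: "is_ring_hom f \<Longrightarrow> bij f \<Longrightarrow> is_ring_hom (inv f)"
  unfolding is_ring_hom_def by (auto simp: inv_f_eq bij_is_inj bij_is_surj surj_f_inv_f)

lemma is_ring_hom_map_poly: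
  fixes f :: "'a::comm_ring_1 \<Rightarrow> 'b::comm_ring_1"
  assumes "is_ring_hom f" shows "is_ring_hom (map_poly f)"
  unfolding is_ring_hom_def
  using assms
  by (auto intro!: poly_eqI simp: is_ring_homD coeff_map_poly coeff_mult is_ring_hom_sum)

lemma is_ring_hom_poly: "is_ring_hom (\<lambda>f. poly f (x :: 'a::comm_ring_1))"
  by (simp add: is_ring_hom_def)

lemma is_ring_hom_pcompose: "is_ring_hom (\<lambda>f. pcompose f (g :: 'a::comm_ring_1 poly))"
  by (simp add: is_ring_hom_def pcompose_add pcompose_mult pcompose_1)

lemma is_ring_hom_const_poly: "is_ring_hom (\<lambda>x :: 'a::comm_ring_1. [:x:])"
  by (simp add: is_ring_hom_def)

section \<open>Reduction to monomials, and evaluation of polynomials\<close>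

lemma mpoly_eq_sum_single:
  "(\<Sum>u\<in>Poly_Mapping.keys G. Poly_Mapping.single u (Poly_Mapping.lookup G u)) = G"
  by (rule poly_mapping_eqI)
     (auto simp: lookup_sum lookup_single when_def in_keys_iff)

text \<open>A polynomial is the finite sum of its monomials. Multiplicativity of evaluation and of
  Frobenius, and the projection formula for psi, are checked on monomials by this principle and its
  two-variable form.\<close>

lemma additive_mpoly_eqI:
  fixes f g :: "'a::comm_monoid_add mpoly \<Rightarrow> 'b::ab_group_add"
  assumes "\<And>G H. f (G + H) = f G + f H" "\<And>G H. g (G + H) = g G + g H"
    and "\<And>u x. f (Poly_Mapping.single u x) = g (Poly_Mapping.single u x)"
  shows "f G = g G"
proof -
  have 0: "f 0 = 0" "g 0 = 0" using assms(1)[of 0 0] assms(2)[of 0 0] by auto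
  have "f (\<Sum>u\<in>A. Poly_Mapping.single u (c u)) = g (\<Sum>u\<in>A. Poly_Mapping.single u (c u))" for A c
    by (induction A rule: infinite_finite_induct) (auto simp: assms 0)
  from this[of "Poly_Mapping.lookup G" "Poly_Mapping.keys G"] show ?thesis
    by (simp only: mpoly_eq_sum_single)
qed

lemma biadditive_mpoly_eqI:
  fixes f g :: "'a::comm_monoid_add mpoly \<Rightarrow> 'a mpoly \<Rightarrow> 'b::ab_group_add"
  assumes "\<And>G G' H. f (G + G') H = f G H + f G' H" "\<And>G H H'. f G (H + H') = f G H + f G H'"
    and "\<And>G G' H. g (G + G') H = g G H + g G' H" "\<And>G H H'. g G (H + H') = g G H + g G H'"
    and "\<And>u x v y. f (Poly_Mapping.single u x) (Poly_Mapping.single v y)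
           = g (Poly_Mapping.single u x) (Poly_Mapping.single v y)"
  shows "f G H = g G H"
  by (rule additive_mpoly_eqI[of "\<lambda>G. f G H" "\<lambda>G. g G H"], simp_all add: assms)
     (rule additive_mpoly_eqI, simp_all add: assms)

text \<open>Cancellation can make the support of \<open>G + H\<close> smaller than the union of the
  supports; over one common index set additivity holds term by term.\<close>

lemma eval_mpoly_superset:
  assumes "finite A" "Poly_Mapping.keys G \<subseteq> A" "e 0 = 0"
  shows "eval_mpoly n e G c
    = (\<Sum>u\<in>A. e (Poly_Mapping.lookup G u) * (\<Prod>i\<le>n. c i ^ Poly_Mapping.lookup u i))"
  unfolding eval_mpoly_def using assms
  by (intro sum.mono_neutral_left) (auto simp: in_keys_iff)

lemma eval_mpoly_single:
  assumes "e 0 = 0"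
  shows "eval_mpoly n e (Poly_Mapping.single u x) c = e x * (\<Prod>i\<le>n. c i ^ Poly_Mapping.lookup u i)"
  by (subst eval_mpoly_superset[of "{u}"]) (use assms in \<open>auto split: if_splits\<close>)

lemma eval_mpoly_add:
  assumes "e 0 = 0" "\<And>x y. e (x + y) = e x + e y"
  shows "eval_mpoly n e (G + H) c = eval_mpoly n e G c + eval_mpoly n e H c"
proof -
  have sub: "Poly_Mapping.keys (G + H) \<subseteq> Poly_Mapping.keys G \<union> Poly_Mapping.keys H"
    by (rule keys_add)
  show ?thesis
    by (subst (1 2 3) eval_mpoly_superset[of "Poly_Mapping.keys G \<union> Poly_Mapping.keys H"])
       (use assms sub in \<open>auto simp: lookup_add algebra_simps sum.distrib\<close>)
qed

lemma is_ring_hom_eval_mpoly: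
  fixes e :: "'a::comm_ring_1 \<Rightarrow> 'b::comm_ring_1"
  assumes "is_ring_hom e" shows "is_ring_hom (\<lambda>G. eval_mpoly n e G c)"
proof -
  note hom = is_ring_homD[OF assms]
  have add: "eval_mpoly n e (G + H) c = eval_mpoly n e G c + eval_mpoly n e H c" for G H
    by (rule eval_mpoly_add) (simp_all add: hom)
  have "eval_mpoly n e 1 c = 1"
    unfolding single_one[symmetric] by (subst eval_mpoly_single) (simp_all add: hom)
  moreover have "eval_mpoly n e (G * H) c = eval_mpoly n e G c * eval_mpoly n e H c" for G H
    by (rule biadditive_mpoly_eqI[of "\<lambda>G H. eval_mpoly n e (G * H) c"])
       (simp_all add: add algebra_simps mult_single eval_mpoly_single hom lookup_add power_add
          prod.distrib)
  ultimately show ?thesis by (simp add: is_ring_hom_def add)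
qed

lemma eval_mpoly_hom:
  fixes f :: "'b::comm_ring_1 \<Rightarrow> 'c::comm_ring_1"
  assumes "is_ring_hom f"
  shows "f (eval_mpoly n e G c) = eval_mpoly n (\<lambda>x. f (e x)) G (\<lambda>i. f (c i))"
  by (simp add: eval_mpoly_def is_ring_hom_sum[OF assms] is_ring_homD[OF assms]
      is_ring_hom_prod[OF assms])

section \<open>Frobenius and psi on polynomials\<close>

lemma lookup_scale_exp [simp]: "Poly_Mapping.lookup (scale_exp p u) i = p * Poly_Mapping.lookup u i"
  unfolding scale_exp_def by (simp add: map.rep_eq when_def)

lemma scale_exp_add: "scale_exp p (u + v) = scale_exp p u + scale_exp p v"
  by (rule poly_mapping_eqI) (simp add: lookup_add algebra_simps)

lemma scale_exp_0 [simp]: "scale_exp p 0 = 0"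
  by (rule poly_mapping_eqI) simp

lemma scale_exp_scale_exp: "scale_exp a (scale_exp b u) = scale_exp (a * b) u"
  by (rule poly_mapping_eqI) simp

lemma inj_scale_exp: "p > 0 \<Longrightarrow> inj (scale_exp p)"
  by (auto intro!: injI simp: poly_mapping_eq_iff fun_eq_iff) blast?

text \<open>Used contrapositively: if \<open>p\<close> does not divide the exponent
  \<open>b\<close>, then it does not divide \<open>scale_exp p a + b\<close>, and psi kills both
  monomials.\<close>

lemma scale_exp_split:
  assumes "p > 0" "scale_exp p a + b = scale_exp p u"
  shows "\<exists>b'. b = scale_exp p b' \<and> u = a + b'"
proof -
  have eq: "p * Poly_Mapping.lookup a i + Poly_Mapping.lookup b i = p * Poly_Mapping.lookup u i" for i
    using arg_cong[OF assms(2), of "\<lambda>x. Poly_Mapping.lookup x i"] by (simp add: lookup_add)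
  have le: "Poly_Mapping.lookup a i \<le> Poly_Mapping.lookup u i" for i
    using eq[of i] assms(1) by (metis le_add1 mult_le_cancel1)
  have u: "u = a + (u - a)"
    by (rule poly_mapping_eqI) (use le in \<open>simp add: lookup_add lookup_minus\<close>)
  moreover have "b = scale_exp p (u - a)"
    by (rule poly_mapping_eqI) (use eq in \<open>simp add: lookup_minus diff_mult_distrib2 flip: eq\<close>)
  ultimately show ?thesis by blast
qed

text \<open>\<open>Abs_poly_mapping\<close> has the expected values only for finite support. Scaling
  by \<open>p > 0\<close> is injective, so the preimage of the support of \<open>G\<close> is
  finite.\<close>

lemma lookup_psi_op:
  assumes "p > 0" "g 0 = 0"
  shows "Poly_Mapping.lookup (psi_op p g G) u = g (Poly_Mapping.lookup G (scale_exp p u))"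
proof -
  have "finite (scale_exp p -` Poly_Mapping.keys G)"
    using assms by (intro finite_vimageI inj_scale_exp) auto
  moreover have "{u. g (Poly_Mapping.lookup G (scale_exp p u)) \<noteq> 0} \<subseteq> scale_exp p -` Poly_Mapping.keys G"
    using assms by (auto simp: in_keys_iff)
  ultimately show ?thesis unfolding psi_op_def
    by (subst lookup_Abs_poly_mapping) (auto intro: finite_subset)
qed

text \<open>The operator phi on polynomials, of which psi is a left inverse when \<open>g\<close> is
  one of \<open>phi\<close>. As a finite sum of monomials it needs no proof of finite
  support.\<close>

definition frob_mpoly :: "nat \<Rightarrow> ('a::comm_monoid_add \<Rightarrow> 'a) \<Rightarrow> 'a mpoly \<Rightarrow> 'a mpoly" where
  "frob_mpoly p phi G =
     (\<Sum>u\<in>Poly_Mapping.keys G. Poly_Mapping.single (scale_exp p u) (phi (Poly_Mapping.lookup G u)))"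

lemma frob_mpoly_superset:
  assumes "finite A" "Poly_Mapping.keys G \<subseteq> A" "phi 0 = 0"
  shows "frob_mpoly p phi G
    = (\<Sum>u\<in>A. Poly_Mapping.single (scale_exp p u) (phi (Poly_Mapping.lookup G u)))"
  unfolding frob_mpoly_def using assms
  by (intro sum.mono_neutral_left) (auto simp: in_keys_iff)

lemma frob_mpoly_single:
  assumes "phi 0 = 0"
  shows "frob_mpoly p phi (Poly_Mapping.single u x) = Poly_Mapping.single (scale_exp p u) (phi x)"
  by (subst frob_mpoly_superset[of "{u}"]) (use assms in \<open>auto split: if_splits\<close>)

lemma frob_mpoly_add:
  assumes "phi 0 = 0" "\<And>x y. phi (x + y) = phi x + phi y"
  shows "frob_mpoly p phi (G + H) = frob_mpoly p phi G + frob_mpoly p phi H"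
proof -
  have sub: "Poly_Mapping.keys (G + H) \<subseteq> Poly_Mapping.keys G \<union> Poly_Mapping.keys H"
    by (rule keys_add)
  show ?thesis
    by (subst (1 2 3) frob_mpoly_superset[of "Poly_Mapping.keys G \<union> Poly_Mapping.keys H"])
       (use assms sub in \<open>auto simp: lookup_add single_add sum.distrib\<close>)
qed

lemma is_ring_hom_frob_mpoly:
  fixes phi :: "'a::comm_ring_1 \<Rightarrow> 'a"
  assumes "is_ring_hom phi" shows "is_ring_hom (frob_mpoly p phi)"
proof -
  note hom = is_ring_homD[OF assms]
  have add: "frob_mpoly p phi (G + H) = frob_mpoly p phi G + frob_mpoly p phi H" for G H
    by (rule frob_mpoly_add) (simp_all add: hom)
  have "frob_mpoly p phi 1 = 1"
    unfolding single_one[symmetric] by (subst frob_mpoly_single) (simp_all add: hom)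
  moreover have "frob_mpoly p phi (G * H) = frob_mpoly p phi G * frob_mpoly p phi H" for G H
    by (rule biadditive_mpoly_eqI[of "\<lambda>G H. frob_mpoly p phi (G * H)"])
       (simp_all add: add algebra_simps mult_single frob_mpoly_single hom scale_exp_add)
  ultimately show ?thesis by (simp add: is_ring_hom_def add)
qed

lemma keys_frob_mpoly:
  "Poly_Mapping.keys (frob_mpoly p phi G) \<subseteq> scale_exp p ` Poly_Mapping.keys G"
  unfolding frob_mpoly_def
  by (rule order.trans[OF keys_sum]) auto

lemma psi_op_add:
  assumes "p > 0" "g 0 = 0" "\<And>x y. g (x + y) = g x + g y"
  shows "psi_op p g (G + H) = psi_op p g G + psi_op p g H"
  by (rule poly_mapping_eqI) (simp add: lookup_psi_op lookup_add assms)

text \<open>The projection formula. On monomials both sides vanish unless \<open>p\<close> divides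
  the exponent \<open>v\<close>; if it does, \<open>g\<close> undoes \<open>phi\<close> on the
  coefficient of \<open>H\<close>.\<close>

lemma psi_op_frob_mult:
  fixes phi g :: "'a::comm_ring_1 \<Rightarrow> 'a"
  assumes "p > 0" "is_ring_hom phi" "is_ring_hom g" "\<And>x. g (phi x) = x"
  shows "psi_op p g (frob_mpoly p phi H * G) = H * psi_op p g G"
proof (rule biadditive_mpoly_eqI[of "\<lambda>H G. psi_op p g (frob_mpoly p phi H * G)"])
  note hom = is_ring_homD[OF assms(2)] is_ring_homD[OF assms(3)]
  fix u x v y
  show "psi_op p g (frob_mpoly p phi (Poly_Mapping.single u x) * Poly_Mapping.single v y)
    = Poly_Mapping.single u x * psi_op p g (Poly_Mapping.single v y)"
  proof (cases "\<exists>v'. v = scale_exp p v'")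
    case True
    then obtain v' where v: "v = scale_exp p v'" ..
    have sg: "psi_op p g (Poly_Mapping.single (scale_exp p w) z) = Poly_Mapping.single w (g z)" for w z
      by (rule poly_mapping_eqI)
         (use inj_scale_exp[OF assms(1)] in
          \<open>auto simp: lookup_psi_op assms(1) hom lookup_single when_def dest: injD\<close>)
    show ?thesis
      by (simp add: v frob_mpoly_single hom mult_single sg assms flip: scale_exp_add)
  next
    case False
    have "psi_op p g (Poly_Mapping.single v y) = 0"
      by (rule poly_mapping_eqI)
         (use False in \<open>auto simp: lookup_psi_op assms(1) hom lookup_single when_def\<close>)
    moreover have "psi_op p g (Poly_Mapping.single (scale_exp p u + v) z) = 0" for z
      by (rule poly_mapping_eqI)
         (use False in \<open>auto simp: lookup_psi_op assms(1) hom lookup_single when_def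
            dest: scale_exp_split[OF assms(1)]\<close>)
    ultimately show ?thesis by (simp add: frob_mpoly_single hom mult_single)
  qed
qed (simp_all add: algebra_simps psi_op_add assms is_ring_homD[OF assms(3)]
       is_ring_homD[OF is_ring_hom_frob_mpoly[OF assms(2)]])

text \<open>By the projection formula each factor \<open>H ^ (p - 1)\<close> moves inside the psi
  operators to its right and picks up one Frobenius twist from each of them.\<close>

lemma A_op_funpow:
  fixes phi g :: "'a::comm_ring_1 \<Rightarrow> 'a"
  assumes "p > 0" "is_ring_hom phi" "is_ring_hom g" "\<And>x. g (phi x) = x"
  shows "(A_op p g H ^^ m) G
    = (psi_op p g ^^ m) ((\<Prod>i<m. (frob_mpoly p phi ^^ i) H ^ (p - 1)) * G)"
proof (induction m)
  case (Suc m)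
  have shift: "H * (psi_op p g ^^ m) G = (psi_op p g ^^ m) ((frob_mpoly p phi ^^ m) H * G)" for H G
  proof (induction m arbitrary: H)
    case (Suc m)
    have "H * (psi_op p g ^^ Suc m) G = psi_op p g (frob_mpoly p phi H * (psi_op p g ^^ m) G)"
      by (simp add: psi_op_frob_mult[OF assms])
    also have "\<dots> = (psi_op p g ^^ Suc m) ((frob_mpoly p phi ^^ Suc m) H * G)"
      by (simp add: Suc funpow_swap1)
    finally show ?case .
  qed simp
  have "(A_op p g H ^^ Suc m) G = psi_op p g (H ^ (p - 1)
      * (psi_op p g ^^ m) ((\<Prod>i<m. (frob_mpoly p phi ^^ i) H ^ (p - 1)) * G))"
    by (simp add: Suc A_op_def)
  also have "\<dots> = (psi_op p g ^^ Suc m) ((frob_mpoly p phi ^^ m) (H ^ (p - 1))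
      * ((\<Prod>i<m. (frob_mpoly p phi ^^ i) H ^ (p - 1)) * G))"
    by (simp add: shift)
  also have "(frob_mpoly p phi ^^ m) (H ^ (p - 1)) = (frob_mpoly p phi ^^ m) H ^ (p - 1)"
    by (intro is_ring_homD is_ring_hom_funpow is_ring_hom_frob_mpoly assms)
  finally show ?case by (simp add: mult_ac)
qed auto

lemma lookup_psi_op_funpow:
  assumes "p > 0" "g 0 = 0"
  shows "Poly_Mapping.lookup ((psi_op p g ^^ m) G) u
    = (g ^^ m) (Poly_Mapping.lookup G (scale_exp (p ^ m) u))"
proof (induction m arbitrary: u)
  case 0
  have "scale_exp 1 u = u" by (rule poly_mapping_eqI) simp
  then show ?case by simp
qed (simp add: lookup_psi_op assms scale_exp_scale_exp mult.commute)

lemma lookup_mult_single: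
  fixes G :: "'a::comm_ring_1 mpoly"
  shows "Poly_Mapping.lookup (G * Poly_Mapping.single w 1) (v + w) = Poly_Mapping.lookup G v"
  by (rule additive_mpoly_eqI[of "\<lambda>G. Poly_Mapping.lookup (G * Poly_Mapping.single w 1) (v + w)"])
     (auto simp: algebra_simps lookup_add mult_single lookup_single when_def)

section \<open>Homogeneous polynomials and the trace formula\<close>

lemma Bdeg_add: "u \<in> Bdeg n k \<Longrightarrow> v \<in> Bdeg n l \<Longrightarrow> u + v \<in> Bdeg n (k + l)"
  using keys_add[of u v] by (auto simp: Bdeg_def lookup_add sum.distrib)

lemma homog_mult: "homog n k G \<Longrightarrow> homog n l H \<Longrightarrow> homog n (k + l) (G * H)"
  using keys_mult[of G H] unfolding homog_def by (blast intro: Bdeg_add)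

lemma homog_one: "homog n 0 (1 :: 'a::comm_ring_1 mpoly)"
  by (auto simp: homog_def Bdeg_def)

lemma homog_power: "homog n k (G :: 'a::comm_ring_1 mpoly) \<Longrightarrow> homog n (k * s) (G ^ s)"
  by (induction s) (auto simp: homog_one homog_mult)

lemma homog_prod:
  fixes G :: "'b \<Rightarrow> 'a::comm_ring_1 mpoly"
  shows "(\<And>i. i \<in> A \<Longrightarrow> homog n (k i) (G i)) \<Longrightarrow> homog n (sum k A) (prod G A)"
  by (induction A rule: infinite_finite_induct) (auto simp: homog_one homog_mult)

lemma scale_exp_in_Bdeg: "u \<in> Bdeg n k \<Longrightarrow> scale_exp p u \<in> Bdeg n (p * k)"
  by (auto simp: Bdeg_def in_keys_iff subset_iff simp flip: sum_distrib_left)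

lemma homog_frob_mpoly: "homog n k G \<Longrightarrow> homog n (p * k) (frob_mpoly p phi G)"
  using keys_frob_mpoly[of p phi G] scale_exp_in_Bdeg[of _ n k p]
  unfolding homog_def by blast

lemma homog_frob_mpoly_funpow: "homog n k G \<Longrightarrow> homog n (p ^ m * k) ((frob_mpoly p phi ^^ m) G)"
  by (induction m) (auto simp: mult.assoc dest: homog_frob_mpoly)

lemma lookup_Bdeg_eq_0: "u \<in> Bdeg n k \<Longrightarrow> \<not> i \<le> n \<Longrightarrow> Poly_Mapping.lookup u i = 0"
  unfolding Bdeg_def in_keys_iff subset_iff by (metis (mono_tags, lifting) atMost_iff mem_Collect_eq)

lemma finite_Bdeg: "finite (Bdeg n k)"
proof -
  have "inj_on (\<lambda>u. restrict (Poly_Mapping.lookup u) {..n}) (Bdeg n k)"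
  proof (rule inj_onI)
    fix u v assume u: "u \<in> Bdeg n k" and v: "v \<in> Bdeg n k"
      and eq: "restrict (Poly_Mapping.lookup u) {..n} = restrict (Poly_Mapping.lookup v) {..n}"
    show "u = v"
    proof (rule poly_mapping_eqI)
      fix i show "Poly_Mapping.lookup u i = Poly_Mapping.lookup v i"
        using fun_cong[OF eq, of i] u v
        by (cases "i \<le> n") (auto simp: lookup_Bdeg_eq_0)
    qed
  qed
  moreover have "(\<lambda>u. restrict (Poly_Mapping.lookup u) {..n}) ` Bdeg n k \<subseteq> PiE {..n} (\<lambda>_. {..k})"
    by (auto simp: Bdeg_def intro: member_le_sum split: if_splits)
  ultimately show ?thesis
    by (meson finite_PiE finite_atMost finite_imageD finite_subset)
qed

text \<open>With \<open>N = p ^ m - 1\<close>, the left side consists of the exponents that survive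
  the character sums; the right side is indexed by the basis over which the trace is taken.\<close>

lemma Bdeg_divisible:
  assumes "N > 0"
  shows "{u \<in> Bdeg n (N * k). \<forall>i\<le>n. N dvd Poly_Mapping.lookup u i} = scale_exp N ` Bdeg n k"
proof (intro equalityI subsetI)
  fix u assume u: "u \<in> {u \<in> Bdeg n (N * k). \<forall>i\<le>n. N dvd Poly_Mapping.lookup u i}"
  have dvd: "N dvd Poly_Mapping.lookup u i" for i
    using u lookup_Bdeg_eq_0[of u n "N * k" i] by (cases "i \<le> n") auto
  define v where "v = Poly_Mapping.map (\<lambda>x. x div N) u"
  have v: "Poly_Mapping.lookup v i = Poly_Mapping.lookup u i div N" for i
    by (simp add: v_def map.rep_eq when_def)
  have uv: "u = scale_exp N v"
    by (rule poly_mapping_eqI) (use dvd in \<open>simp add: v\<close>)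
  have "v \<in> Bdeg n k"
    using u assms unfolding uv Bdeg_def
    by (auto simp: in_keys_iff subset_iff simp flip: sum_distrib_left)
  with uv show "u \<in> scale_exp N ` Bdeg n k" by blast
qed (auto intro: scale_exp_in_Bdeg)

text \<open>The diagonal entry at \<open>w\<close> is the coefficient of the product times
  \<open>x^w\<close> at \<open>p ^ m\<close> times \<open>w\<close>, that is, of the product itself
  at \<open>p ^ m - 1\<close> times \<open>w\<close>. The twist \<open>g ^^ m\<close> on
  coefficients is the identity.\<close>

lemma trace_A_pow_eq:
  fixes phi g :: "'a::comm_ring_1 \<Rightarrow> 'a"
  assumes "p > 0" "is_ring_hom phi" "is_ring_hom g" "\<And>x. g (phi x) = x" "\<And>x. (g ^^ m) x = x"
  shows "trace_A_pow n p g H m k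
    = (\<Sum>w\<in>Bdeg n k. Poly_Mapping.lookup (\<Prod>i<m. (frob_mpoly p phi ^^ i) H ^ (p - 1))
        (scale_exp (p ^ m - 1) w))"
  unfolding trace_A_pow_def
proof (intro sum.cong refl)
  fix w
  have "scale_exp (p ^ m) w = scale_exp (p ^ m - 1) w + w"
    by (rule poly_mapping_eqI) (use assms(1) in \<open>simp add: lookup_add algebra_simps\<close>)
  then show "Poly_Mapping.lookup ((A_op p g H ^^ m) (Poly_Mapping.single w 1)) w
    = Poly_Mapping.lookup (\<Prod>i<m. (frob_mpoly p phi ^^ i) H ^ (p - 1)) (scale_exp (p ^ m - 1) w)"
    by (simp add: A_op_funpow[OF assms(1-4)] lookup_psi_op_funpow assms(1,5) lookup_mult_single
        is_ring_homD[OF assms(3)])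
qed

section \<open>The coefficients alpha\<close>

text \<open>The power series of \<open>(1 - z)^(-lam)\<close> cut off before \<open>z ^ tau\<close>.
  For \<open>lam = 0\<close> natural subtraction still gives the right coefficients: 1 at
  \<open>t = 0\<close> and 0 afterwards.\<close>

definition neg_binom_trunc :: "nat \<Rightarrow> nat \<Rightarrow> 'a::comm_ring_1 \<Rightarrow> 'a" where
  "neg_binom_trunc lam tau z = (\<Sum>t<tau. of_nat ((lam + t - 1) choose t) * z ^ t)"

text \<open>Pascal's rule lowers the exponent by one; the truncation leaves a single boundary
  term.\<close>

lemma neg_binom_trunc_Suc:
  "(1 - z) * neg_binom_trunc (Suc lam) (Suc tau) z
    = neg_binom_trunc lam (Suc tau) z - of_nat ((lam + tau) choose tau) * z ^ Suc tau"
proof (induction tau)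
  case 0
  show ?case by (simp add: neg_binom_trunc_def)
next
  case (Suc tau)
  have pas: "(of_nat (Suc (lam + tau) choose Suc tau) :: 'a)
      = of_nat ((lam + tau) choose Suc tau) + of_nat ((lam + tau) choose tau)"
    by (simp add: add.commute)
  have "neg_binom_trunc (Suc lam) (Suc (Suc tau)) z
      = neg_binom_trunc (Suc lam) (Suc tau) z + of_nat ((lam + Suc tau) choose Suc tau) * z ^ Suc tau"
    by (simp add: neg_binom_trunc_def del: binomial_Suc_Suc)
  moreover have "neg_binom_trunc lam (Suc (Suc tau)) z
      = neg_binom_trunc lam (Suc tau) z + of_nat ((lam + tau) choose Suc tau) * z ^ Suc tau"
    by (simp add: neg_binom_trunc_def del: binomial_Suc_Suc)
  ultimately show ?case using Suc
    by (simp del: binomial_Suc_Suc add: algebra_simps pas)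
qed

text \<open>Each of the \<open>lam\<close> factors \<open>1 - z\<close> leaves an error divisible by
  \<open>z ^ tau\<close>. Only this divisibility matters later, so the cofactor is not made
  explicit.\<close>

lemma neg_binom_trunc_inverse:
  assumes "tau \<ge> 1"
  shows "\<exists>h. (1 - z) ^ lam * neg_binom_trunc lam tau z = 1 + z ^ tau * h"
proof -
  obtain t where tau: "tau = Suc t" using assms by (cases tau) auto
  show ?thesis unfolding tau
  proof (induction lam)
    case 0
    have "neg_binom_trunc 0 (Suc t) z = (\<Sum>i\<in>{0}. of_nat ((i - 1) choose i) * z ^ i)"
      unfolding neg_binom_trunc_def by (rule sum.mono_neutral_cong_right) (auto simp: binomial_eq_0)
    then show ?case by (intro exI[of _ 0]) simp
  next
    case (Suc lam)
    then obtain h where h: "(1 - z) ^ lam * neg_binom_trunc lam (Suc t) z = 1 + z ^ Suc t * h" ..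
    have "(1 - z) ^ Suc lam * neg_binom_trunc (Suc lam) (Suc t) z
      = (1 - z) ^ lam * ((1 - z) * neg_binom_trunc (Suc lam) (Suc t) z)"
      by (simp add: mult_ac)
    also have "\<dots> = (1 - z) ^ lam * neg_binom_trunc lam (Suc t) z
        - (1 - z) ^ lam * (of_nat ((lam + t) choose t) * z ^ Suc t)"
      by (simp only: neg_binom_trunc_Suc right_diff_distrib)
    also have "\<dots> = 1 + z ^ Suc t * (h - (1 - z) ^ lam * of_nat ((lam + t) choose t))"
      by (simp only: h) (simp add: algebra_simps)
    finally show ?case by blast
  qed
qed

text \<open>\<open>alpha_coeff\<close> is the Cauchy product of the coefficients of
  \<open>(1 - z) ^ lam\<close> with those of the truncated inverse; the signs combine to
  \<open>(-1) ^ (s - t)\<close>.\<close>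

lemma alpha_coeff_sum:
  fixes z :: "'a::comm_ring_1"
  shows "(\<Sum>s<lam + tau. of_int (alpha_coeff lam tau s) * z ^ s)
    = (1 - z) ^ lam * neg_binom_trunc lam tau z"
proof -
  define b :: "nat \<Rightarrow> 'a" where "b t = of_nat ((lam + t - 1) choose t) * z ^ t" for t
  define c :: "nat \<Rightarrow> 'a" where "c j = (-1) ^ j * of_nat (lam choose j) * z ^ j" for j
  have coeff: "of_int (alpha_coeff lam tau s) * z ^ s = (\<Sum>t<tau. if t \<le> s then b t * c (s - t) else 0)" for s
    unfolding alpha_coeff_def of_int_mult of_int_sum sum_distrib_left sum_distrib_right
  proof (intro sum.cong refl)
    fix t
    have sgn: "(-1) ^ s * (-1) ^ t = ((-1) ^ (s - t) :: 'a)" if "t \<le> s"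
    proof -
      have "(-1) ^ s = ((-1) ^ (s - t) * (-1) ^ t :: 'a)" using that by (simp flip: power_add)
      moreover have "(-1) ^ t * (-1) ^ t = (1 :: 'a)" by (simp flip: power_mult_distrib)
      ultimately show ?thesis by (simp add: mult.assoc)
    qed
    have zz: "z ^ t * z ^ (s - t) = z ^ s" if "t \<le> s" using that by (simp flip: power_add)
    show "of_int ((-1) ^ s) * (of_int ((-1) ^ t) * of_int (int (lam + t - 1 choose t))
        * of_int (if t \<le> s then int (lam choose (s - t)) else 0)) * z ^ s
      = (if t \<le> s then b t * c (s - t) else 0)"
    proof (cases "t \<le> s")
      case True
      have "of_int ((-1) ^ s) * (of_int ((-1) ^ t) * of_int (int (lam + t - 1 choose t))
          * of_int (if t \<le> s then int (lam choose (s - t)) else 0)) * z ^ s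
        = ((-1) ^ s * (-1) ^ t)
          * (of_nat (lam + t - 1 choose t) * of_nat (lam choose (s - t))) * z ^ s"
        using True by (simp add: mult.assoc)
      also have "\<dots> = (-1) ^ (s - t)
          * (of_nat (lam + t - 1 choose t) * of_nat (lam choose (s - t))) * (z ^ t * z ^ (s - t))"
        by (simp only: sgn[OF True] zz[OF True])
      also have "\<dots> = b t * c (s - t)" by (simp only: b_def c_def mult_ac)
      finally show ?thesis using True by simp
    qed simp
  qed
  have cpow: "(1 - z) ^ lam = (\<Sum>j\<le>lam. c j)"
    using binomial_ring[of "- z" 1 lam]
    by (simp add: c_def power_minus[of z] mult_ac)
  \<comment> \<open>As \<open>t < tau\<close> and \<open>j \<le> lam\<close>, every
    \<open>s = t + j\<close> lies below \<open>lam + tau\<close>, so the range of \<open>s\<close>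
    cuts off nothing of the product.\<close>
  have inner: "(\<Sum>s<lam + tau. if t \<le> s then b t * c (s - t) else 0) = b t * (\<Sum>j\<le>lam. c j)"
    if "t < tau" for t
  proof -
    have "(\<Sum>s<lam + tau. if t \<le> s then b t * c (s - t) else 0)
      = (\<Sum>s\<in>(\<lambda>j. j + t) ` {..lam}. if t \<le> s then b t * c (s - t) else 0)"
    proof (rule sum.mono_neutral_right)
      show "\<forall>s\<in>{..<lam + tau} - (\<lambda>j. j + t) ` {..lam}. (if t \<le> s then b t * c (s - t) else 0) = 0"
      proof
        fix s assume s: "s \<in> {..<lam + tau} - (\<lambda>j. j + t) ` {..lam}"
        have "s - t > lam" if "t \<le> s"
        proof (rule ccontr)
          assume "\<not> s - t > lam"
          then have "s \<in> (\<lambda>j. j + t) ` {..lam}" using that by (intro image_eqI[of _ _ "s - t"]) auto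
          with s show False by simp
        qed
        then show "(if t \<le> s then b t * c (s - t) else 0) = 0" by (simp add: c_def binomial_eq_0)
      qed
    qed (use that in auto)
    also have "\<dots> = (\<Sum>j\<le>lam. b t * c j)"
      by (subst sum.reindex) (auto simp: inj_on_def)
    finally show ?thesis by (simp add: sum_distrib_left)
  qed
  have "(\<Sum>s<lam + tau. of_int (alpha_coeff lam tau s) * z ^ s)
      = (\<Sum>t<tau. \<Sum>s<lam + tau. if t \<le> s then b t * c (s - t) else 0)"
    unfolding coeff by (rule sum.swap)
  also have "\<dots> = (\<Sum>t<tau. b t) * (\<Sum>j\<le>lam. c j)"
    by (simp add: inner sum_distrib_right)
  finally show ?thesis by (simp add: cpow neg_binom_trunc_def b_def mult_ac)
qed

section \<open>Primitive elements of finite fields\<close>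

lemma finite_field_power_card:
  fixes x :: "'a::{finite,field}"
  assumes "x \<noteq> 0" shows "x ^ (card (UNIV :: 'a set) - 1) = 1"
proof -
  have "(\<Prod>y\<in>UNIV-{0}. x * y) = (\<Prod>y\<in>UNIV-{0}. y)"
    by (rule prod.reindex_bij_witness[of _ "\<lambda>y. y / x" "\<lambda>y. x * y"]) (use assms in auto)
  moreover have "(\<Prod>y\<in>UNIV-{0}. x * y) = x ^ (card (UNIV :: 'a set) - 1) * \<Prod>(UNIV-{0})"
    by (simp add: prod.distrib)
  moreover have "\<Prod>(UNIV-{0::'a}) \<noteq> 0" by simp
  ultimately show ?thesis by simp
qed

lemma card_finite_field_gt_1: "card (UNIV :: 'a::{finite,field} set) > 1"
proof -
  have "card {0, 1 :: 'a} \<le> card (UNIV :: 'a set)" by (rule card_mono) auto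
  then show ?thesis by simp
qed

lemma power_eq_1_coprime:
  fixes x :: "'a::field"
  assumes "x ^ a = 1" "x ^ b = 1" "coprime a b"
  shows "x = 1"
proof (cases "a = 0")
  case False
  obtain u v where "u * a = v * b + gcd a b" using bezout_nat[OF False, of b] by (metis mult.commute)
  then have "x ^ (u * a) = x ^ (v * b + 1)" using assms(3) by simp
  then show ?thesis using assms by (simp add: power_add power_mult mult.commute[of u] mult.commute[of v])
qed (use assms in auto)

lemma power_eq_1_gcd:
  fixes x :: "'a::field"
  assumes "x ^ a = 1" "x ^ b = 1"
  shows "x ^ gcd a b = 1"
proof (cases "a = 0")
  case False
  obtain u v where uv: "u * a = v * b + gcd a b" using bezout_nat[OF False, of b] by (metis mult.commute)
  have "x ^ (u * a) = 1" "x ^ (v * b) = 1"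
    using assms by (simp_all add: power_mult mult.commute[of u] mult.commute[of v])
  then show ?thesis unfolding uv power_add by simp
qed (use assms in auto)

text \<open>The polynomial \<open>x^k - 1\<close> has at most \<open>k\<close> roots, fewer than
  there are nonzero field elements.\<close>

lemma exists_power_neq_1:
  assumes "k > 0" "k < card (UNIV :: 'a set) - 1"
  obtains x :: "'a::{finite,field}" where "x \<noteq> 0" "x ^ k \<noteq> 1"
proof -
  have "\<exists>x::'a. x \<noteq> 0 \<and> x ^ k \<noteq> 1"
  proof (rule ccontr)
    assume "\<not> ?thesis"
    then have sub: "UNIV - {0} \<subseteq> {x::'a. poly (monom 1 k - 1) x = 0}"
      by (auto simp: poly_monom)
    have ne: "monom 1 k - 1 \<noteq> (0 :: 'a poly)"
    proof
      assume "monom 1 k - 1 = (0 :: 'a poly)"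
      then have "coeff (monom 1 k - 1) k = (0 :: 'a)" by simp
      with assms(1) show False by simp
    qed
    have "card (UNIV - {0::'a}) \<le> card {x::'a. poly (monom 1 k - 1) x = 0}"
      using sub by (intro card_mono) auto
    also have "\<dots> \<le> Polynomial.degree (monom 1 k - 1 :: 'a poly)"
      by (rule card_poly_roots_bound[OF ne])
    also have "\<dots> \<le> k"
      by (rule degree_diff_le) (auto simp: degree_monom_le)
    finally show False using assms(2) by simp
  qed
  then show ?thesis using that by blast
qed

text \<open>For each prime \<open>l\<close> dividing \<open>N\<close> an element of order exactly
  \<open>l ^ v l\<close> is built; the product of these elements has order \<open>N\<close>.\<close>

lemma finite_field_primitive_element:
  obtains g :: "'a::{finite,field}" where "g \<noteq> 0"
    "\<And>k. g ^ k = 1 \<longleftrightarrow> (card (UNIV :: 'a set) - 1) dvd k"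
proof -
  define N where "N = card (UNIV :: 'a set) - 1"
  have N: "N > 0" using card_finite_field_gt_1[where 'a = 'a] by (simp add: N_def)
  have N1: "x ^ N = 1" if "x \<noteq> 0" for x :: 'a
    using finite_field_power_card[OF that] by (simp add: N_def)
  have "\<exists>x::'a. x \<noteq> 0 \<and> x ^ (N div l) \<noteq> 1" if "l \<in> prime_factors N" for l
  proof -
    from that have l: "prime l" "l dvd N" by (auto simp: in_prime_factors_iff)
    then have "N div l > 0" "N div l < N"
      using N prime_gt_1_nat[of l] by (auto simp: div_greater_zero_iff dvd_imp_le)
    then show ?thesis
      using exists_power_neq_1[where 'a = 'a, of "N div l"] by (metis N_def)
  qed
  then obtain x :: "nat \<Rightarrow> 'a" where x: "\<And>l. l \<in> prime_factors N \<Longrightarrow> x l \<noteq> 0 \<and> x l ^ (N div l) \<noteq> 1"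
    by metis
  define v where "v l = multiplicity l N" for l
  define y where "y l = x l ^ (N div l ^ v l)" for l
  define g where "g = (\<Prod>l\<in>prime_factors N. y l)"
  have y0: "y l \<noteq> 0" if "l \<in> prime_factors N" for l using x[OF that] by (simp add: y_def)
  have yN: "y l ^ (l ^ v l) = x l ^ N" for l
  proof -
    have "N div l ^ v l * l ^ v l = N" by (simp add: v_def multiplicity_dvd)
    then show ?thesis by (metis y_def power_mult)
  qed
  have g0: "g \<noteq> 0" using y0 by (simp add: g_def)
  \<comment> \<open>An element whose order divides \<open>N\<close> has order exactly
    \<open>N\<close> as soon as no power \<open>N div l\<close> of it is 1.\<close>
  have gl: "g ^ (N div l) \<noteq> 1" if l: "l \<in> prime_factors N" for l
  proof
    assume eq: "g ^ (N div l) = 1"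
    have pl: "prime l" "l dvd N" using l by (auto simp: in_prime_factors_iff)
    have vl: "v l > 0" using pl N by (simp add: v_def prime_multiplicity_gt_zero_iff)
    have "\<not> is_unit l" "N \<noteq> 0" using pl N by auto
    then obtain b where Nb: "N = l ^ v l * b" and "\<not> l dvd b"
      unfolding v_def by (metis multiplicity_decompose')
    then have cop: "coprime b l" 
      using pl prime_imp_coprime[of l b] by (simp add: coprime_commute)
    have yl_def: "y l = x l ^ b"
    proof -
      have "N div l ^ v l = b"
        using pl by (metis Nb nonzero_mult_div_cancel_left not_prime_0 power_not_zero)
      then show ?thesis by (simp add: y_def)
    qed
    \<comment> \<open>The factors for the other primes disappear: \<open>l' ^ v l'\<close> divides
      \<open>N\<close> and is coprime to \<open>l\<close>, hence divides
      \<open>N div l\<close>.\<close>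
    have other: "y l' ^ (N div l) = 1" if l': "l' \<in> prime_factors N" "l' \<noteq> l" for l'
    proof -
      have pl': "prime l'" using l' by (auto simp: in_prime_factors_iff)
      have "coprime (l' ^ v l') l" using pl pl' l' by (simp add: primes_coprime)
      moreover have "l' ^ v l' dvd l * (N div l)" using pl by (simp add: v_def multiplicity_dvd)
      ultimately have "l' ^ v l' dvd N div l" by (simp add: coprime_dvd_mult_right_iff)
      then obtain c where c: "N div l = l' ^ v l' * c" ..
      have "y l' ^ (l' ^ v l') = 1" unfolding yN using N1 x l' by blast
      then show ?thesis by (simp add: c power_mult)
    qed
    have "g ^ (N div l) = y l ^ (N div l) * (\<Prod>l'\<in>prime_factors N - {l}. y l' ^ (N div l))"
      unfolding g_def by (simp add: prod.remove[OF _ l] power_mult_distrib prod_power_distrib)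
    then have yl: "y l ^ (N div l) = 1" using eq other by simp
    have Nl: "N div l = l ^ (v l - 1) * b"
    proof -
      have "N = l * (l ^ (v l - 1) * b)"
        using vl by (subst Nb) (cases "v l", simp_all add: mult_ac)
      then show ?thesis using pl by (metis nonzero_mult_div_cancel_left not_prime_0)
    qed
    \<comment> \<open>This element is killed by the coprime exponents \<open>b\<close> and
      \<open>l\<close>, so it is 1; but it equals \<open>x l ^ (N div l)\<close>, which was chosen
      different from 1.\<close>
    have "(y l ^ (l ^ (v l - 1))) ^ b = 1" using yl by (simp add: Nl power_mult)
    moreover have "(y l ^ (l ^ (v l - 1))) ^ l = 1"
    proof -
      have "(y l ^ (l ^ (v l - 1))) ^ l = y l ^ (l ^ v l)"
      proof -
        have "l ^ v l = l ^ (v l - 1) * l" using vl by (simp flip: power_Suc2)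
        then show ?thesis by (simp only: power_mult)
      qed
      also have "\<dots> = 1" unfolding yN using N1 x l by blast
      finally show ?thesis .
    qed
    ultimately have "y l ^ (l ^ (v l - 1)) = 1" using cop by (rule power_eq_1_coprime)
    moreover have "y l ^ (l ^ (v l - 1)) = x l ^ (N div l)"
      by (simp only: yl_def Nl power_mult[symmetric] mult.commute)
    ultimately show False using x[OF l] by simp
  qed
  have "N dvd k" if k: "g ^ k = 1" for k
  proof (rule ccontr)
    assume "\<not> N dvd k"
    \<comment> \<open>If the order were a proper divisor of \<open>N\<close>, some prime
      \<open>l\<close> would divide the quotient, and the power \<open>N div l\<close> of
      \<open>g\<close> would be 1.\<close>
    define e where "e = gcd N k"
    have e1: "g ^ e = 1" unfolding e_def using N1[OF g0] k by (rule power_eq_1_gcd)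
    have "e dvd N" by (simp add: e_def)
    moreover have "e \<noteq> N" using \<open>\<not> N dvd k\<close> by (metis e_def gcd_dvd2)
    ultimately obtain c where c: "N = e * c" and "c \<noteq> 1" by (metis dvdE mult.right_neutral)
    then obtain l where l: "prime l" "l dvd c" using prime_factor_nat by blast
    then obtain c' where "c = l * c'" by (auto simp: dvd_def)
    then have "N div l = e * c'" using c l prime_gt_0_nat[of l] by simp
    then have "g ^ (N div l) = 1" using e1 by (simp add: power_mult)
    moreover have "l \<in> prime_factors N" using c l N by (auto simp: in_prime_factors_iff)
    ultimately show False using gl by blast
  qed
  moreover have "g ^ k = 1" if dvd: "N dvd k" for k
  proof -
    obtain c where "k = N * c" using dvd ..
    then show ?thesis using N1[OF g0] by (simp add: power_mult)
  qed
  ultimately have iff: "g ^ k = 1 \<longleftrightarrow> N dvd k" for k by blast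
  show ?thesis by (rule that[OF g0 iff[unfolded N_def]])
qed

lemma primitive_element_bij:
  fixes g :: "'a::{finite,field}"
  assumes "g \<noteq> 0" "\<And>k. g ^ k = 1 \<longleftrightarrow> (card (UNIV :: 'a set) - 1) dvd k"
  shows "bij_betw (\<lambda>i. g ^ i) {..<card (UNIV :: 'a set) - 1} (UNIV - {0})"
proof -
  have inj: "inj_on (\<lambda>i. g ^ i) {..<card (UNIV :: 'a set) - 1}"
  proof (rule linorder_inj_onI)
    fix i j assume ij: "i < j" "i \<in> {..<card (UNIV :: 'a set) - 1}" "j \<in> {..<card (UNIV :: 'a set) - 1}"
    show "g ^ i \<noteq> g ^ j"
    proof
      assume eq: "g ^ i = g ^ j"
      have "g ^ j = g ^ i * g ^ (j - i)" using ij by (simp flip: power_add)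
      with eq assms(1) have "g ^ (j - i) = 1" by simp
      then have "card (UNIV :: 'a set) - 1 dvd j - i" using assms(2) by blast
      with ij show False by (auto dest!: dvd_imp_le)
    qed
  qed auto
  moreover have "(\<lambda>i. g ^ i) ` {..<card (UNIV :: 'a set) - 1} = UNIV - {0}"
    by (rule card_subset_eq) (use assms(1) inj in \<open>auto simp: card_image\<close>)
  ultimately show ?thesis by (simp add: bij_betw_def)
qed

section \<open>Teichmueller points modulo powers of p\<close>

lemma cong_ideal_iff_dvd: "cong_ideal m x y \<longleftrightarrow> m dvd (x - y)"
  by (auto simp: cong_ideal_def dvd_def)

lemma dvd_power_diff: "(x - y :: 'a::comm_ring_1) dvd x ^ k - y ^ k"
  by (simp add: power_diff_sumr2)

text \<open>In \<open>X^p - Y^p = (X - Y) * (\<Sum>i<p. Y ^ (p - Suc i) * X ^ i)\<close> the second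
  factor is congruent to \<open>p * Y ^ (p - 1)\<close> modulo \<open>p\<close>, so each
  \<open>p\<close>-th power gains a factor \<open>p\<close>.\<close>

lemma prime_power_dvd_diff_power:
  fixes x y :: "'a::comm_ring_1"
  assumes "of_nat p dvd x - y" "p > 0"
  shows "of_nat p ^ Suc k dvd x ^ (p ^ k) - y ^ (p ^ k)"
proof (induction k)
  case (Suc k)
  define X Y where "X = x ^ (p ^ k)" and "Y = y ^ (p ^ k)"
  have c: "of_nat p ^ Suc k dvd X - Y" using Suc by (simp only: X_def Y_def)
  then have p: "of_nat p dvd X - Y" by (meson dvd_power dvd_trans zero_less_Suc)
  have "of_nat p dvd (\<Sum>i<p. Y ^ (p - Suc i) * (X ^ i - Y ^ i))"
    by (intro dvd_sum dvd_mult dvd_trans[OF p] dvd_power_diff)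
  moreover have "(\<Sum>i<p. Y ^ (p - Suc i) * X ^ i)
    = (\<Sum>i<p. Y ^ (p - Suc i) * (X ^ i - Y ^ i)) + of_nat p * Y ^ (p - 1)"
  proof -
    have "(\<Sum>i<p. Y ^ (p - Suc i) * Y ^ i) = (\<Sum>i<p. Y ^ (p - 1))"
      by (intro sum.cong) (auto simp flip: power_add)
    then show ?thesis by (simp add: right_diff_distrib sum_subtractf)
  qed
  ultimately have "of_nat p dvd (\<Sum>i<p. Y ^ (p - Suc i) * X ^ i)" by simp
  with c have "of_nat p ^ Suc k * of_nat p dvd (X - Y) * (\<Sum>i<p. Y ^ (p - Suc i) * X ^ i)"
    by (rule mult_dvd_mono)
  then have "of_nat p ^ Suc (Suc k) dvd X ^ p - Y ^ p"
    by (simp only: power_diff_sumr2 power_Suc2 mult_ac)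
  then show ?case by (simp add: X_def Y_def mult.commute flip: power_mult)
qed (use assms in simp)

text \<open>Modulo \<open>p\<close> every element is a \<open>q\<^sup>M\<close>-th power, and congruence modulo \<open>p\<close> improves to
  congruence modulo \<open>p\<^sup>M\<close> under such powers; so an endomorphism that is trivial modulo \<open>p\<close> is
  trivial modulo every \<open>p\<^sup>M\<close>.\<close>
lemma witt_endomorphism_trivial:
  fixes red :: "'w::comm_ring_1 \<Rightarrow> 'k::{finite,field}"
  assumes witt: "is_witt_ring p red" and "p > 0" "a \<ge> 1" "card (UNIV :: 'k set) = p ^ a"
    and hom: "is_ring_hom s" and s: "\<And>x. red (s x) = red x"
  shows "s x = x"
proof -
  have red: "is_ring_hom red" and ker: "\<And>x. red x = 0 \<longleftrightarrow> of_nat p dvd x"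
    using witt by (auto simp: is_witt_ring_def dvd_def)
  have sep: "x = 0" if "\<And>M. of_nat p ^ M dvd x" for x :: 'w
    using witt that unfolding is_witt_ring_def cong_ideal_iff_dvd by simp
  note redD = is_ring_homD[OF red] and sD = is_ring_homD[OF hom]
  have card: "y ^ (p ^ (a * M)) = y" for y :: 'k and M
  proof (induction M)
    case (Suc M)
    have q: "y ^ (p ^ a) = y"
    proof (cases "y = 0")
      case False
      then show ?thesis
        using finite_field_power_card[of y] \<open>p > 0\<close> assms(4) power_minus_mult[of "p ^ a" y] by simp
    qed (use \<open>p > 0\<close> in simp)
    have "y ^ (p ^ (a * Suc M)) = (y ^ (p ^ a)) ^ (p ^ (a * M))"
      by (simp add: power_add flip: power_mult)
    then show ?case by (simp add: q Suc)
  qed simp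
  have "of_nat p ^ M dvd s x - x" for M
  proof (induction M arbitrary: x)
    case (Suc M)
    define y where "y = x ^ (p ^ (a * M))"
    have "red (x - y) = 0" by (simp add: y_def redD card)
    then obtain x' where x': "x - y = of_nat p * x'" by (auto simp: ker dvd_def)
    then have x: "x = y + of_nat p * x'" by (simp add: algebra_simps)
    have "red (s x - x) = 0" by (simp add: redD s)
    then have "of_nat p dvd s x - x" by (simp add: ker)
    then have "of_nat p ^ Suc (a * M) dvd s x ^ (p ^ (a * M)) - x ^ (p ^ (a * M))"
      by (rule prime_power_dvd_diff_power) (rule \<open>p > 0\<close>)
    moreover have "(of_nat p :: 'w) ^ Suc M dvd of_nat p ^ Suc (a * M)"
      using \<open>a \<ge> 1\<close> by (intro le_imp_power_dvd) simp
    ultimately have 1: "of_nat p ^ Suc M dvd s y - y"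
      by (auto simp: y_def sD intro: dvd_trans)
    have 2: "of_nat p ^ Suc M dvd of_nat p * (s x' - x')"
      using Suc by (simp add: mult_dvd_mono)
    have "s x - x = (s y - y) + of_nat p * (s x' - x')"
      unfolding x by (simp add: sD algebra_simps)
    then show ?case using 1 2 by (metis dvd_add)
  qed simp
  then have "s x - x = 0" by (rule sep)
  then show ?thesis by simp
qed

lemma red_frobenius_funpow:
  assumes "is_frobenius_lift p red phi"
  shows "red ((phi ^^ k) x) = red x ^ (p ^ k)"
  using assms by (induction k) (auto simp: is_frobenius_lift_def mult.commute simp flip: power_mult)

text \<open>On the residue field \<open>phi ^^ a\<close> induces the \<open>p ^ a\<close>-th power
  map, which is the identity there; by rigidity \<open>phi ^^ a\<close> is the identity.\<close>

lemma frobenius_lift_funpow_eq: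
  fixes red :: "'w::comm_ring_1 \<Rightarrow> 'k::{finite,field}"
  assumes "is_witt_ring p red" "is_frobenius_lift p red phi" "p > 0" "a \<ge> 1"
    "card (UNIV :: 'k set) = p ^ a"
  shows "(phi ^^ (a * r)) x = x"
proof -
  have "(phi ^^ a) x = x" for x
  proof (rule witt_endomorphism_trivial[OF assms(1,3-5)])
    show "is_ring_hom (phi ^^ a)"
      using assms(2) by (intro is_ring_hom_funpow) (simp add: is_frobenius_lift_def)
    have "y ^ (p ^ a) = y" for y :: 'k
      using finite_field_power_card[of y] assms(3,5) power_minus_mult[of "p ^ a" y]
      by (cases "y = 0") auto
    then show "red ((phi ^^ a) x) = red x" for x
      by (simp add: red_frobenius_funpow[OF assms(2)])
  qed
  then have "phi ^^ a = id" by auto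
  then show ?thesis by (simp add: funpow_mult[symmetric])
qed

lemma inv_frobenius_lift_funpow_eq:
  fixes red :: "'w::comm_ring_1 \<Rightarrow> 'k::{finite,field}"
  assumes "is_witt_ring p red" "is_frobenius_lift p red phi" "p > 0" "a \<ge> 1"
    "card (UNIV :: 'k set) = p ^ a"
  shows "(inv phi ^^ (a * r)) x = x"
proof -
  have "phi ^^ (a * r) = id" using frobenius_lift_funpow_eq[OF assms] by auto
  moreover have "inv (phi ^^ (a * r)) = inv phi ^^ (a * r)"
    using assms(2) by (intro inv_fn) (simp add: is_frobenius_lift_def)
  ultimately show ?thesis by (metis id_apply inv_id)
qed

text \<open>In the application \<open>m\<close> is \<open>a * r\<close>, \<open>e\<close> embeds the
  field of \<open>q\<close> elements into the field of \<open>q ^ r\<close> elements, and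
  \<open>\<theta>\<close> is a primitive element of the latter.\<close>

locale torus_points =
  fixes p m :: nat
    and red :: "'w::comm_ring_1 \<Rightarrow> 'k::{finite,field}"
    and phi :: "'w \<Rightarrow> 'w"
    and e :: "'k \<Rightarrow> 'K::{finite,field}"
    and \<theta> :: 'K
  assumes prime: "prime p"
    and witt: "is_witt_ring p red"
    and frob: "is_frobenius_lift p red phi"
    and e: "is_ring_hom e"
    and card_K: "card (UNIV :: 'K set) = p ^ m"
    and theta_nz: "\<theta> \<noteq> 0"
    and theta_order: "\<And>k. \<theta> ^ k = 1 \<longleftrightarrow> (p ^ m - 1) dvd k"
begin

abbreviation N :: nat where "N \<equiv> p ^ m - 1"

definition residue :: "'w poly \<Rightarrow> 'K" where
  "residue f = poly (map_poly e (map_poly red f)) \<theta>"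

text \<open>Modulo \<open>T\<close> the variable is an \<open>N\<close>-th root of unity, as a
  Teichmueller lift of \<open>\<theta>\<close> must be.\<close>

definition T :: "'w poly" where "T = monom 1 N - 1"

text \<open>\<open>J M\<close> is the ideal generated by \<open>p\<^sup>M\<close> and \<open>T\<close> in the localisation of \<open>W[t]\<close> at the maximal
  ideal \<open>ker residue\<close>; the quotient by it is a copy of the Witt vectors of length \<open>M\<close> over the
  big field, in which \<open>t\<close> is the Teichmueller lift of \<open>\<theta>\<close>.\<close>
definition J :: "nat \<Rightarrow> 'w poly \<Rightarrow> bool" where
  "J M f \<longleftrightarrow> (\<exists>s g h. residue s \<noteq> 0 \<and> s * f = of_nat p ^ M * g + T * h)"

lemma red: "is_ring_hom red" and surj_red: "surj red"
  and red_eq_0: "red x = 0 \<longleftrightarrow> (\<exists>y. x = of_nat p * y)"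
  and p_cancel: "of_nat p * x = 0 \<Longrightarrow> x = 0"
  using witt by (auto simp: is_witt_ring_def)

lemma phi: "is_ring_hom phi" and bij_phi: "bij phi" and red_phi: "red (phi x) = red x ^ p"
  using frob by (auto simp: is_frobenius_lift_def)

lemma is_ring_hom_residue: "is_ring_hom residue"
  unfolding residue_def
  by (intro is_ring_hom_comp[OF is_ring_hom_poly] is_ring_hom_comp[OF is_ring_hom_map_poly[OF e]]
      is_ring_hom_map_poly red)

lemmas residueD = is_ring_homD[OF is_ring_hom_residue]
lemmas eD = is_ring_homD[OF e]
lemmas redD = is_ring_homD[OF red]
lemmas map_redD = is_ring_homD[OF is_ring_hom_map_poly[OF red]]
lemmas map_eD = is_ring_homD[OF is_ring_hom_map_poly[OF e]]

lemma residue_const: "residue [:x:] = e (red x)"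
  by (simp add: residue_def map_poly_pCons redD eD)

lemma residue_monom: "residue (monom 1 k) = \<theta> ^ k"
  by (simp add: residue_def map_poly_monom redD eD poly_monom)

lemma residue_pCons: "residue (pCons a f) = e (red a) + \<theta> * residue f"
  by (simp add: residue_def map_poly_pCons redD eD)

lemma of_nat_p_K: "(of_nat p :: 'K) = 0"
proof -
  have "red (of_nat p) = 0" unfolding red_eq_0 by (rule exI[of _ 1]) simp
  then show ?thesis by (simp add: redD eD) (metis eD(4,8))
qed

lemma p_gt_0: "p > 0" using prime by (rule prime_gt_0_nat)

lemma m_gt_0: "m > 0"
  using card_finite_field_gt_1[where 'a = 'K] card_K by (cases m) auto

lemma N_gt_0: "N > 0"
  using card_finite_field_gt_1[where 'a = 'K] card_K by simp

lemma e_eq_0: "e x = 0 \<longleftrightarrow> x = 0"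
proof
  assume "e x = 0"
  show "x = 0"
  proof (rule ccontr)
    assume "x \<noteq> 0"
    then have "e (x * inverse x) = 1" by (simp add: eD)
    then show False using \<open>e x = 0\<close> by (simp only: eD) simp
  qed
qed (simp add: eD)

lemma residue_T: "residue T = 0"
  by (simp add: T_def residueD residue_monom) (simp add: theta_order)

section \<open>The ideals \<open>J M\<close> and their congruences\<close>

lemma J_0: "J 0 f"
  unfolding J_def by (rule exI[of _ 1], rule exI[of _ f], rule exI[of _ 0]) (simp add: residueD)

lemma J_mono:
  assumes "J M f" "M' \<le> M" shows "J M' f"
proof -
  obtain s g h where s: "residue s \<noteq> 0" "s * f = of_nat p ^ M * g + T * h"
    using assms by (auto simp: J_def)
  have "s * f = of_nat p ^ M' * (of_nat p ^ (M - M') * g) + T * h"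
    using s assms(2) by (simp flip: power_add mult.assoc)
  with s(1) show ?thesis unfolding J_def by blast
qed

lemma J_add:
  assumes "J M f" "J M f'" shows "J M (f + f')"
proof -
  obtain s g h s' g' h' where s: "residue s \<noteq> 0" "s * f = of_nat p ^ M * g + T * h"
    "residue s' \<noteq> 0" "s' * f' = of_nat p ^ M * g' + T * h'"
    using assms by (auto simp: J_def)
  have "(s * s') * (f + f') = s' * (s * f) + s * (s' * f')" by (simp add: algebra_simps)
  also have "\<dots> = of_nat p ^ M * (s' * g + s * g') + T * (s' * h + s * h')"
    unfolding s by (simp add: algebra_simps)
  finally show ?thesis using s unfolding J_def
    by (metis mult_eq_0_iff residueD(3))
qed

lemma J_ideal:
  assumes "J M f" shows "J M (c * f)"
proof -
  obtain s g h where s: "residue s \<noteq> 0" "s * f = of_nat p ^ M * g + T * h"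
    using assms by (auto simp: J_def)
  have "s * (c * f) = c * (s * f)" by (simp add: mult_ac)
  also have "\<dots> = of_nat p ^ M * (c * g) + T * (c * h)"
    unfolding s by (simp add: algebra_simps)
  finally show ?thesis using s unfolding J_def by blast
qed

lemma J_mult:
  assumes "J M f" "J M' f'" shows "J (M + M') (f * f')"
proof -
  obtain s g h s' g' h' where s: "residue s \<noteq> 0" "s * f = of_nat p ^ M * g + T * h"
    "residue s' \<noteq> 0" "s' * f' = of_nat p ^ M' * g' + T * h'"
    using assms by (auto simp: J_def)
  have "(s * s') * (f * f') = (s * f) * (s' * f')" by (simp add: mult_ac)
  also have "\<dots> = of_nat p ^ (M + M') * (g * g')
      + T * (of_nat p ^ M * g * h' + h * (of_nat p ^ M' * g') + T * h * h')"
    unfolding s by (simp add: algebra_simps power_add)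
  finally show ?thesis using s unfolding J_def
    by (metis mult_eq_0_iff residueD(3))
qed

lemma J_power: "J M f \<Longrightarrow> J (M * k) (f ^ k)"
  by (induction k) (auto simp: J_0 J_mult)

lemma J_uminus: "J M f \<Longrightarrow> J M (- f)"
  using J_ideal[of M f "-1"] by simp

lemma J_prod:
  "finite A \<Longrightarrow> (\<And>i. i \<in> A \<Longrightarrow> J 1 (f i)) \<Longrightarrow> J (card A) (prod f A)"
  by (induction A rule: finite_induct) (auto simp: J_0 intro: J_mult[of 1, simplified])

lemma J_T: "J M T"
  unfolding J_def by (rule exI[of _ 1], rule exI[of _ 0], rule exI[of _ 1]) (simp add: residueD)

text \<open>An element with nonzero residue is a unit of the localisation: it is absorbed into the
  multiplier \<open>s\<close>.\<close>

lemma J_cancel: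
  assumes "J M (c * f)" "residue c \<noteq> 0" shows "J M f"
proof -
  obtain s g h where s: "residue s \<noteq> 0" "s * (c * f) = of_nat p ^ M * g + T * h"
    using assms by (auto simp: J_def)
  then have "(s * c) * f = of_nat p ^ M * g + T * h" by (simp add: mult.assoc)
  then show ?thesis using s(1) assms(2) unfolding J_def
    by (metis mult_eq_0_iff residueD(3))
qed

definition Jcong :: "nat \<Rightarrow> 'w poly \<Rightarrow> 'w poly \<Rightarrow> bool" where
  "Jcong M f g \<longleftrightarrow> J M (f - g)"

lemma Jcong_refl: "Jcong M f f"
  using J_ideal[OF J_T, of M 0] by (simp add: Jcong_def)

lemma Jcong_trans: "Jcong M f g \<Longrightarrow> Jcong M g h \<Longrightarrow> Jcong M f h"
  unfolding Jcong_def using J_add[of M "f - g" "g - h"] by simp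

lemma Jcong_sym: "Jcong M f g \<Longrightarrow> Jcong M g f"
  unfolding Jcong_def using J_uminus[of M "f - g"] by simp

lemma Jcong_add: "Jcong M f g \<Longrightarrow> Jcong M f' g' \<Longrightarrow> Jcong M (f + f') (g + g')"
  unfolding Jcong_def using J_add[of M "f - g" "f' - g'"] by (simp add: algebra_simps)

lemma Jcong_mult:
  assumes "Jcong M f g" "Jcong M f' g'" shows "Jcong M (f * f') (g * g')"
proof -
  have "f * f' - g * g' = f' * (f - g) + g * (f' - g')" by (simp add: algebra_simps)
  then show ?thesis using assms unfolding Jcong_def by (simp add: J_add J_ideal)
qed

lemma Jcong_sum: "(\<And>i. i \<in> A \<Longrightarrow> Jcong M (f i) (g i)) \<Longrightarrow> Jcong M (sum f A) (sum g A)"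
  by (induction A rule: infinite_finite_induct) (auto simp: Jcong_refl Jcong_add)

lemma Jcong_prod: "(\<And>i. i \<in> A \<Longrightarrow> Jcong M (f i) (g i)) \<Longrightarrow> Jcong M (prod f A) (prod g A)"
  by (induction A rule: infinite_finite_induct) (auto simp: Jcong_refl Jcong_mult)

lemma Jcong_power: "Jcong M f g \<Longrightarrow> Jcong M (f ^ k) (g ^ k)"
  by (induction k) (auto simp: Jcong_refl Jcong_mult)

lemma map_poly_red_surj: "\<exists>f. map_poly red f = g"
proof -
  \<comment> \<open>\<open>map_poly\<close> acts on each coefficient only if 0 goes to 0, which
    \<open>inv red\<close> need not satisfy. The function \<open>d\<close> of the next divisibility
    lemma is normalised at 0 for the same reason.\<close>
  define c where "c x = (if x = 0 then 0 else inv red x)" for x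
  have "map_poly red (map_poly c g) = g"
    by (rule poly_eqI) (simp add: coeff_map_poly c_def redD surj_f_inv_f[OF surj_red])
  then show ?thesis ..
qed

lemma of_nat_mult_poly: "of_nat k * (f :: 'w poly) = smult (of_nat k) f"
  by (simp add: of_nat_poly)

lemma map_poly_red_eq_0: "map_poly red f = 0 \<Longrightarrow> \<exists>g. f = of_nat p * g"
proof -
  assume 0: "map_poly red f = 0"
  have "\<exists>d. x = of_nat p * d \<and> (x = 0 \<longrightarrow> d = 0)" if "red x = 0" for x
    using that by (cases "x = 0") (auto simp: red_eq_0)
  then obtain d where d: "\<And>x. red x = 0 \<Longrightarrow> x = of_nat p * d x" "d 0 = 0"
    using redD(4) by metis
  have "red (coeff f k) = 0" for k
    using arg_cong[OF 0, of "\<lambda>f. coeff f k"] by (simp add: coeff_map_poly redD)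
  then have "f = of_nat p * map_poly d f"
    by (intro poly_eqI) (simp add: of_nat_mult_poly coeff_map_poly d(2) flip: d(1))
  then show ?thesis ..
qed

lemma map_poly_red_of_nat_p: "map_poly red (of_nat p * f) = 0"
proof -
  have "red (of_nat p) = 0" unfolding red_eq_0 by (rule exI[of _ 1]) simp
  then show ?thesis
    by (intro poly_eqI) (simp add: of_nat_mult_poly coeff_map_poly redD)
qed

lemma p_cancel_poly:
  assumes "of_nat p * f = of_nat p * (g :: 'w poly)" shows "f = g"
proof (rule poly_eqI)
  fix k
  have "of_nat p * (coeff f k - coeff g k) = 0"
    using arg_cong[OF assms, of "\<lambda>f. coeff f k"] by (simp add: of_nat_mult_poly right_diff_distrib)
  then show "coeff f k = coeff g k" using p_cancel by force
qed

text \<open>Modulo \<open>p\<close>, \<open>T\<close> is the product of the minimal polynomial of \<open>\<theta>\<close> and a cofactor not vanishing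
  at \<open>\<theta>\<close>, as \<open>T\<close> is separable; a lift of this cofactor multiplies \<open>ker residue\<close> into \<open>(p, T)\<close>.\<close>
lemma J_residue_0:
  assumes "residue f = 0" shows "J 1 f"
proof -
  define ev where "ev g = poly (map_poly e g) \<theta>" for g
  have ev: "is_ring_hom ev" unfolding ev_def
    by (intro is_ring_hom_comp[OF is_ring_hom_poly] is_ring_hom_map_poly e)
  note evD = is_ring_homD[OF ev]
  have res: "residue g = ev (map_poly red g)" for g by (simp add: residue_def ev_def)
  define Tk where "Tk = map_poly red T"
  have Tk: "Tk = monom 1 N - 1"
    by (simp add: Tk_def T_def map_redD map_poly_monom redD)
  have Tk0: "Tk \<noteq> 0"
  proof
    assume "Tk = 0"
    then have "coeff Tk N = 0" by simp
    then show False using N_gt_0 by (simp add: Tk)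
  qed
  have evT: "ev Tk = 0" using residue_T by (simp add: res Tk_def)
  obtain g where g: "g \<noteq> 0" "ev g = 0"
    and min: "\<And>h. h \<noteq> 0 \<Longrightarrow> ev h = 0 \<Longrightarrow> Polynomial.degree g \<le> Polynomial.degree h"
    using ex_has_least_nat[of "\<lambda>h. h \<noteq> 0 \<and> ev h = 0" Tk Polynomial.degree] Tk0 evT by blast
  have gdvd: "g dvd h" if "ev h = 0" for h
  proof -
    have "ev (h div g * g + h mod g) = 0" using that by simp
    then have "ev (h mod g) = 0" unfolding evD g(2) by simp
    then have "h mod g = 0" using min[of "h mod g"] degree_mod_less[of g h] g(1) by force
    then show ?thesis by (simp add: mod_eq_0_iff_dvd)
  qed
  obtain e0 where e0: "Tk = g * e0" using gdvd[OF evT] ..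
  have "ev e0 \<noteq> 0"
  proof
    \<comment> \<open>Then \<open>\<theta>\<close> would be a double root of \<open>t^N - 1\<close>.
      But the derivative there is \<open>N * \<theta> ^ (N - 1)\<close>, and \<open>N\<close> is
      \<open>- 1\<close> in the big field because \<open>m > 0\<close>.\<close>
    assume 0: "ev e0 = 0"
    have "pderiv (map_poly e Tk) = map_poly e g * pderiv (map_poly e e0)
        + map_poly e e0 * pderiv (map_poly e g)"
      unfolding e0 map_eD by (rule pderiv_mult)
    then have "poly (pderiv (map_poly e Tk)) \<theta> = 0"
      using 0 g(2) by (simp add: ev_def)
    moreover have "map_poly e Tk = monom 1 N - 1"
      by (simp add: Tk map_eD map_poly_monom eD)
    ultimately have "of_nat N * \<theta> ^ (N - 1) = 0"
      by (simp add: pderiv_diff pderiv_monom poly_monom)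
    moreover have "(of_nat N :: 'K) = - 1"
      using p_gt_0 m_gt_0 by (simp add: of_nat_diff of_nat_p_K power_0_left)
    ultimately show False using theta_nz by simp
  qed
  obtain E where E: "map_poly red E = e0" using map_poly_red_surj by blast
  have "g dvd map_poly red f" using assms gdvd by (simp add: res)
  then obtain h where h: "map_poly red f = g * h" ..
  obtain H where H: "map_poly red H = h" using map_poly_red_surj by blast
  have "map_poly red (E * f - T * H) = 0"
    by (simp only: map_redD E h H Tk_def[symmetric]) (simp add: e0 mult_ac)
  then obtain g' where "E * f - T * H = of_nat p * g'" using map_poly_red_eq_0 by blast
  then have "E * f = of_nat p ^ 1 * g' + T * H" by (simp add: algebra_simps)
  moreover have "residue E \<noteq> 0" using \<open>ev e0 \<noteq> 0\<close> by (simp add: res E)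
  ultimately show ?thesis unfolding J_def by blast
qed

text \<open>Brings congruences back to \<open>W\<close>. Taking residues shows that \<open>p\<close>
  divides \<open>w\<close>; then the whole relation can be divided by \<open>p\<close>, with the
  same \<open>s\<close>, and induction on \<open>M\<close> applies.\<close>

lemma J_const:
  assumes "J M [:w:]" shows "of_nat p ^ M dvd w"
proof -
  obtain s g h where s: "residue s \<noteq> 0" and eq: "s * [:w:] = of_nat p ^ M * g + T * h"
    using assms by (auto simp: J_def)
  from eq show ?thesis
  proof (induction M arbitrary: w h)
    case (Suc M)
    have "residue (s * [:w:]) = 0"
      unfolding Suc.prems by (simp add: residueD residue_T of_nat_p_K)
    then have "e (red w) = 0" using s by (simp add: residueD residue_const del: mult_pCons_right)
    then have "red w = 0" by (simp add: e_eq_0)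
    then obtain w' where w': "w = of_nat p * w'" by (auto simp: red_eq_0)
    have sw: "s * [:w:] = of_nat p * (s * [:w':])"
    proof -
      have "[:w:] = of_nat p * [:w':]" by (simp add: w' of_nat_poly)
      then show ?thesis by (simp only: mult.left_commute)
    qed
    \<comment> \<open>Now \<open>p\<close> divides \<open>T * h\<close>. As \<open>T\<close> is
      nonzero modulo \<open>p\<close> and polynomials over a field have no zero divisors,
      \<open>p\<close> divides \<open>h\<close>.\<close>
    have "map_poly red (T * h) = map_poly red (of_nat p * (s * [:w':] - of_nat p ^ M * g))"
      using Suc.prems unfolding sw by (simp add: algebra_simps)
    also have "\<dots> = 0" by (rule map_poly_red_of_nat_p)
    finally have "map_poly red T * map_poly red h = 0" by (simp add: map_redD)
    moreover have "coeff (map_poly red T) N \<noteq> 0"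
      using N_gt_0 by (simp add: T_def map_redD map_poly_monom redD)
    then have "map_poly red T \<noteq> 0" by auto
    ultimately have "map_poly red h = 0" by simp
    then obtain h' where h': "h = of_nat p * h'" using map_poly_red_eq_0 by blast
    have "of_nat p * (s * [:w':]) = of_nat p * (of_nat p ^ M * g + T * h')"
      using Suc.prems unfolding sw h' by (simp add: algebra_simps)
    then have "s * [:w':] = of_nat p ^ M * g + T * h'" by (rule p_cancel_poly)
    then have "of_nat p ^ M dvd w'" by (rule Suc.IH)
    then show ?case by (simp add: w' mult_dvd_mono)
  qed simp
qed

section \<open>The Frobenius lift on \<open>W[t]\<close> and the norm\<close>

text \<open>Besides acting by \<open>phi\<close> on coefficients it sends \<open>t\<close> to
  \<open>t^p\<close>, as Frobenius does with Teichmueller lifts; \<open>residue\<close> turns it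
  into the \<open>p\<close>-th power map.\<close>

definition \<Phi> :: "'w poly \<Rightarrow> 'w poly" where
  "\<Phi> f = pcompose (map_poly phi f) (monom 1 p)"

lemma is_ring_hom_Phi: "is_ring_hom \<Phi>"
  unfolding \<Phi>_def by (intro is_ring_hom_comp[OF is_ring_hom_pcompose] is_ring_hom_map_poly phi)

lemmas PhiD = is_ring_homD[OF is_ring_hom_Phi]
lemmas phiD = is_ring_homD[OF phi]

lemma Phi_const: "\<Phi> [:x:] = [:phi x:]"
  by (simp add: \<Phi>_def map_poly_pCons phiD)

lemma monom_power: "monom (1 :: 'w) i ^ k = monom 1 (i * k)"
  by (induction k) (simp_all add: mult_monom flip: one_poly_eq_simps(1) monom_eq_1)

lemma Phi_monom: "\<Phi> (monom 1 i) = monom 1 (p * i)"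
proof -
  have "\<Phi> (monom 1 i) = \<Phi> (monom 1 1) ^ i"
    by (simp add: monom_power flip: PhiD)
  also have "\<Phi> (monom 1 1) = monom 1 p"
  proof -
    have "monom (1 :: 'w) 1 = [:0, 1:]" by (simp add: monom_altdef)
    then show ?thesis by (simp add: \<Phi>_def map_poly_pCons phiD pcompose_pCons)
  qed
  finally show ?thesis by (simp add: monom_power)
qed

lemma residue_Phi: "residue (\<Phi> f) = residue f ^ p"
proof (induction f)
  case (pCons a f)
  have "CHAR('K) = p"
  proof -
    have "CHAR('K) dvd p" using of_nat_p_K by (simp add: of_nat_eq_0_iff_char_dvd)
    moreover have "CHAR('K) \<noteq> 1"
    proof
      assume "CHAR('K) = 1"
      then have "(of_nat 1 :: 'K) = 0" unfolding of_nat_eq_0_iff_char_dvd by simp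
      then show False by simp
    qed
    ultimately show ?thesis using prime by (metis prime_nat_iff)
  qed
  then have frob: "(x + y) ^ p = x ^ p + y ^ p" for x y :: 'K
    using prime by (intro freshmans_dream) auto
  have "\<Phi> (pCons a f) = [:phi a:] + monom 1 p * \<Phi> f"
    by (simp add: \<Phi>_def map_poly_pCons phiD pcompose_pCons)
  then show ?case
    by (simp add: residueD residue_const residue_monom residue_pCons pCons.IH red_phi eD frob
        power_mult_distrib)
qed (simp add: PhiD residueD p_gt_0)

lemma residue_Phi_funpow: "residue ((\<Phi> ^^ i) f) = residue f ^ (p ^ i)"
  by (induction i) (simp_all add: residue_Phi mult.commute flip: power_mult)

text \<open>The product of the \<open>m\<close> conjugates models the norm from the unramified
  extension of degree \<open>m\<close> down to the \<open>p\<close>-adic integers.\<close>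

definition frob_norm :: "'w poly \<Rightarrow> 'w poly" where
  "frob_norm y = (\<Prod>i<m. (\<Phi> ^^ i) y) ^ (p - 1)"

lemma frob_norm_power: "frob_norm (y ^ s) = frob_norm y ^ s"
proof -
  have "(\<Phi> ^^ i) (y ^ s) = (\<Phi> ^^ i) y ^ s" for i
    by (rule is_ring_homD[OF is_ring_hom_funpow[OF is_ring_hom_Phi]])
  then show ?thesis
    by (simp add: frob_norm_def prod_power_distrib mult.commute flip: power_mult)
qed

text \<open>All \<open>m\<close> conjugates lie in \<open>J 1\<close>, and the product is raised to
  the power \<open>p - 1\<close>: this is the source of the factor \<open>(p - 1)ar\<close> in the
  bound on \<open>tau\<close>.\<close>

lemma J_frob_norm:
  assumes "residue y = 0" shows "J (m * (p - 1)) (frob_norm y)"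
proof -
  have "J 1 ((\<Phi> ^^ i) y)" for i
    using assms p_gt_0 by (intro J_residue_0) (simp add: residue_Phi_funpow power_0_left)
  then have "J m (\<Prod>i<m. (\<Phi> ^^ i) y)" using J_prod[of "{..<m}"] by simp
  then show ?thesis unfolding frob_norm_def by (rule J_power)
qed

text \<open>The residue is \<open>residue y\<close> to the power
  \<open>(p - 1) * (1 + p + ... + p^(m-1)) = N\<close>, which is 1.\<close>

lemma J_frob_norm_unit:
  assumes "residue y \<noteq> 0" shows "J 1 (1 - frob_norm y)"
proof (rule J_residue_0)
  have "residue (frob_norm y) = (\<Prod>i<m. residue y ^ (p ^ i)) ^ (p - 1)"
    by (simp add: frob_norm_def residueD is_ring_hom_prod[OF is_ring_hom_residue] residue_Phi_funpow)
  also have "\<dots> = residue y ^ ((\<Sum>i<m. p ^ i) * (p - 1))"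
    by (simp add: power_sum power_mult)
  also have "(\<Sum>i<m. p ^ i) * (p - 1) = N"
  proof -
    have "int ((\<Sum>i<m. p ^ i) * (p - 1)) = int N"
      using power_diff_1_eq[of "int p" m] p_gt_0 by (simp add: of_nat_diff mult.commute)
    then show ?thesis by (simp only: of_nat_eq_iff)
  qed
  also have "residue y ^ N = 1"
    using finite_field_power_card[OF assms] by (simp add: card_K)
  finally show "residue (1 - frob_norm y) = 0" by (simp add: residueD)
qed

text \<open>The bound on \<open>tau\<close> is used for a vanishing residue only: it puts
  \<open>frob_norm y ^ tau\<close> into \<open>J lam\<close>. For a unit the factor
  \<open>(1 - frob_norm y) ^ lam\<close> suffices.\<close>

lemma alpha_frob_norm:
  assumes "tau \<ge> 1" "lam \<le> m * (p - 1) * tau"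
  shows "Jcong lam (\<Sum>s<lam + tau. of_int (alpha_coeff lam tau s) * frob_norm y ^ s)
    (of_bool (residue y = 0))"
proof (cases "residue y = 0")
  case True
  obtain h where "(1 - frob_norm y) ^ lam * neg_binom_trunc lam tau (frob_norm y)
      = 1 + frob_norm y ^ tau * h"
    using neg_binom_trunc_inverse[OF assms(1)] by blast
  moreover have "J lam (h * frob_norm y ^ tau)"
    using J_power[OF J_frob_norm[OF True]] assms(2) by (intro J_ideal) (rule J_mono)
  ultimately show ?thesis using True
    by (simp add: Jcong_def alpha_coeff_sum mult.commute)
next
  case False
  have "J lam ((1 - frob_norm y) ^ lam)"
    using J_power[OF J_frob_norm_unit[OF False], of lam] by simp
  then have "J lam (neg_binom_trunc lam tau (frob_norm y) * (1 - frob_norm y) ^ lam)"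
    by (rule J_ideal)
  then show ?thesis using False
    by (simp add: Jcong_def alpha_coeff_sum mult.commute)
qed

section \<open>Teichmueller points and character sums\<close>

text \<open>A Teichmueller point of the torus is encoded by the exponents \<open>c i\<close> of its
  coordinates \<open>t^(c i)\<close>.\<close>

definition ev :: "nat \<Rightarrow> (nat \<Rightarrow> nat) \<Rightarrow> 'w mpoly \<Rightarrow> 'w poly" where
  "ev n c G = eval_mpoly n (\<lambda>x. [:x:]) G (\<lambda>i. monom 1 (c i))"

lemma is_ring_hom_ev: "is_ring_hom (ev n c)"
  unfolding ev_def by (intro is_ring_hom_eval_mpoly is_ring_hom_const_poly)

lemmas evD = is_ring_homD[OF is_ring_hom_ev]

lemma residue_ev: "residue (ev n c G) = eval_mpoly n (\<lambda>x. e (red x)) G (\<lambda>i. \<theta> ^ c i)"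
  unfolding ev_def
  by (subst eval_mpoly_hom[OF is_ring_hom_residue]) (simp add: residue_const residue_monom)

text \<open>Holds exactly in \<open>W[t]\<close>, not only modulo \<open>J M\<close>: the
  coordinates are powers of \<open>t\<close>, so \<open>\<Phi>\<close> raises them to the
  \<open>p\<close>-th power.\<close>

lemma ev_frob_mpoly: "ev n c (frob_mpoly p phi G) = \<Phi> (ev n c G)"
proof (rule additive_mpoly_eqI[of "\<lambda>G. ev n c (frob_mpoly p phi G)" "\<lambda>G. \<Phi> (ev n c G)"])
  fix u x
  have "\<Phi> (ev n c (Poly_Mapping.single u x))
    = [:phi x:] * (\<Prod>i\<le>n. monom 1 (p * c i) ^ Poly_Mapping.lookup u i)"
    unfolding ev_def
    by (subst eval_mpoly_single)
       (simp_all only: PhiD Phi_const is_ring_hom_prod[OF is_ring_hom_Phi] Phi_monom, simp)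
  moreover have "ev n c (frob_mpoly p phi (Poly_Mapping.single u x))
    = [:phi x:] * (\<Prod>i\<le>n. monom 1 (p * c i) ^ Poly_Mapping.lookup u i)"
    unfolding ev_def
    by (subst frob_mpoly_single, simp add: phiD, subst eval_mpoly_single)
       (simp_all add: monom_power mult_ac)
  ultimately show "ev n c (frob_mpoly p phi (Poly_Mapping.single u x))
    = \<Phi> (ev n c (Poly_Mapping.single u x))" by simp
qed (simp_all add: evD PhiD is_ring_homD[OF is_ring_hom_frob_mpoly[OF phi]])

lemma ev_frob_mpoly_funpow: "ev n c ((frob_mpoly p phi ^^ i) G) = (\<Phi> ^^ i) (ev n c G)"
  by (induction i) (simp_all add: ev_frob_mpoly)

lemma ev_trace_poly:
  "ev n c (\<Prod>i<m. (frob_mpoly p phi ^^ i) (F ^ s) ^ (p - 1)) = frob_norm (ev n c F) ^ s"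
  unfolding frob_norm_power[symmetric]
  by (simp add: is_ring_hom_prod[OF is_ring_hom_ev] evD ev_frob_mpoly_funpow
      frob_norm_def prod_power_distrib)

lemma Jcong_monom_N: "Jcong M (monom 1 N) 1"
  unfolding Jcong_def using J_T by (simp add: T_def)

text \<open>A geometric series in \<open>t^u\<close>. If \<open>N\<close> does not divide
  \<open>u\<close>, then \<open>t^u - 1\<close> has nonzero residue, and its product with the sum is
  \<open>t^(N u) - 1\<close>, which vanishes modulo \<open>T\<close>.\<close>

lemma character_sum:
  "Jcong M (\<Sum>j<N. monom 1 j ^ u) (if N dvd u then of_nat N else 0)"
proof (cases "N dvd u")
  case True
  then obtain v where v: "u = N * v" ..
  have "Jcong M (monom 1 j ^ u) 1" for j
  proof -
    have "monom (1 :: 'w) j ^ u = monom 1 N ^ (j * v)" by (simp add: monom_power v mult_ac)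
    then show ?thesis using Jcong_power[OF Jcong_monom_N, of M "j * v"] by simp
  qed
  then have "Jcong M (\<Sum>j<N. monom 1 j ^ u) (\<Sum>j<N. 1)" by (intro Jcong_sum)
  then show ?thesis using True by simp
next
  case False
  have "residue (monom 1 u - 1) \<noteq> 0"
    using False by (simp add: residueD residue_monom theta_order)
  moreover have "(monom 1 u - 1) * (\<Sum>j<N. monom 1 j ^ u) = monom (1 :: 'w) N ^ u - 1"
    using power_diff_1_eq[of "monom (1 :: 'w) u" N] by (simp add: monom_power mult.commute)
  then have "J M ((monom 1 u - 1) * (\<Sum>j<N. monom 1 j ^ u))"
    using Jcong_power[OF Jcong_monom_N, of M u] by (simp add: Jcong_def)
  ultimately show ?thesis using False J_cancel by (simp add: Jcong_def)
qed

text \<open>For each monomial the sum over points factors into one character sum per coordinate. The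
  surviving exponents are those divisible by \<open>N\<close>, each with weight \<open>N\<close> for
  every one of the \<open>Suc n\<close> coordinates.\<close>

lemma sum_ev:
  assumes "homog n (N * k) P"
  shows "Jcong M (\<Sum>c\<in>PiE {..n} (\<lambda>_. {..<N}). ev n c P)
    [:of_nat N ^ Suc n * (\<Sum>w\<in>Bdeg n k. Poly_Mapping.lookup P (scale_exp N w)):]"
proof -
  define B where "B = Bdeg n (N * k)"
  have "(\<Sum>c\<in>PiE {..n} (\<lambda>_. {..<N}). ev n c P)
    = (\<Sum>c\<in>PiE {..n} (\<lambda>_. {..<N}). \<Sum>u\<in>B.
        [:Poly_Mapping.lookup P u:] * (\<Prod>i\<le>n. monom 1 (c i) ^ Poly_Mapping.lookup u i))"
    unfolding ev_def using assms
    by (intro sum.cong refl eval_mpoly_superset) (simp_all add: B_def finite_Bdeg homog_def)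
  also have "\<dots> = (\<Sum>u\<in>B. \<Sum>c\<in>PiE {..n} (\<lambda>_. {..<N}).
        [:Poly_Mapping.lookup P u:] * (\<Prod>i\<le>n. monom 1 (c i) ^ Poly_Mapping.lookup u i))"
    by (rule sum.swap)
  also have "\<dots> = (\<Sum>u\<in>B. [:Poly_Mapping.lookup P u:]
      * (\<Prod>i\<le>n. \<Sum>j<N. monom 1 j ^ Poly_Mapping.lookup u i))"
    by (intro sum.cong refl) (simp only: prod_sum_PiE[OF finite_atMost finite_lessThan] sum_distrib_left)
  finally have 1: "(\<Sum>c\<in>PiE {..n} (\<lambda>_. {..<N}). ev n c P) = \<dots>" .
  have "Jcong M (\<Sum>u\<in>B. [:Poly_Mapping.lookup P u:]
      * (\<Prod>i\<le>n. \<Sum>j<N. monom 1 j ^ Poly_Mapping.lookup u i))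
    (\<Sum>u\<in>B. [:Poly_Mapping.lookup P u:]
      * (\<Prod>i\<le>n. if N dvd Poly_Mapping.lookup u i then of_nat N else 0))"
    by (intro Jcong_sum Jcong_mult Jcong_prod Jcong_refl character_sum)
  also have "(\<Sum>u\<in>B. [:Poly_Mapping.lookup P u:]
      * (\<Prod>i\<le>n. if N dvd Poly_Mapping.lookup u i then of_nat N else 0))
    = (\<Sum>u\<in>B. [:if \<forall>i\<le>n. N dvd Poly_Mapping.lookup u i
        then of_nat N ^ Suc n * Poly_Mapping.lookup P u else 0:])"
  proof (intro sum.cong refl)
    fix u
    have "(\<Prod>i\<le>n. if N dvd Poly_Mapping.lookup u i then of_nat N else 0)
      = ([:if \<forall>i\<le>n. N dvd Poly_Mapping.lookup u i then of_nat N ^ Suc n else 0:] :: 'w poly)"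
    proof (cases "\<forall>i\<le>n. N dvd Poly_Mapping.lookup u i")
      case True
      then have "(\<Prod>i\<le>n. if N dvd Poly_Mapping.lookup u i then of_nat N else 0)
        = (\<Prod>i\<le>n. of_nat N :: 'w poly)" by (intro prod.cong) auto
      also have "\<dots> = [:of_nat N:] ^ Suc n" by (simp add: of_nat_poly)
      also have "\<dots> = [:of_nat N ^ Suc n:]" by (rule poly_const_pow)
      finally show ?thesis using True by simp
    next
      case False
      then obtain i where "i \<le> n" "\<not> N dvd Poly_Mapping.lookup u i" by blast
      then have "(\<Prod>i\<le>n. if N dvd Poly_Mapping.lookup u i then of_nat N else 0) = (0 :: 'w poly)"
        by (intro prod_zero) auto
      then show ?thesis using False by (simp only: if_False pCons_0_0)
    qed
    moreover have "[:x:] * [:if Q then y else 0:] = [:if Q then y * x else 0:]" for x y :: 'w and Q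
      by (simp add: mult.commute)
    ultimately show "[:Poly_Mapping.lookup P u:]
        * (\<Prod>i\<le>n. if N dvd Poly_Mapping.lookup u i then of_nat N else 0)
      = [:if \<forall>i\<le>n. N dvd Poly_Mapping.lookup u i
          then of_nat N ^ Suc n * Poly_Mapping.lookup P u else 0:]"
      by (simp only:)
  qed
  also have "\<dots> = [:\<Sum>u\<in>B. if \<forall>i\<le>n. N dvd Poly_Mapping.lookup u i
      then of_nat N ^ Suc n * Poly_Mapping.lookup P u else 0:]"
    by (rule is_ring_hom_sum[OF is_ring_hom_const_poly, symmetric])
  also have "(\<Sum>u\<in>B. if \<forall>i\<le>n. N dvd Poly_Mapping.lookup u i
      then of_nat N ^ Suc n * Poly_Mapping.lookup P u else 0)
    = (\<Sum>u\<in>scale_exp N ` Bdeg n k. of_nat N ^ Suc n * Poly_Mapping.lookup P u)"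
    unfolding Bdeg_divisible[OF N_gt_0, symmetric] B_def
    by (rule sum.inter_filter[OF finite_Bdeg, symmetric])
  also have "\<dots> = of_nat N ^ Suc n * (\<Sum>w\<in>Bdeg n k. Poly_Mapping.lookup P (scale_exp N w))"
    using inj_scale_exp[OF N_gt_0]
    by (subst sum.reindex) (auto simp: sum_distrib_left inj_def intro: inj_onI)
  finally show ?thesis using 1 by simp
qed

text \<open>The number of zeros and the weighted traces are both constants in \<open>W[t]\<close>;
  once they agree modulo \<open>J lam\<close>, they agree modulo \<open>p ^ lam\<close> in
  \<open>W\<close>.\<close>

lemma card_zeros_cong:
  assumes "homog n d F" "tau \<ge> 1" "lam \<le> m * (p - 1) * tau"
    and g: "is_ring_hom g" "\<And>x. g (phi x) = x" "\<And>x. (g ^^ m) x = x"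
  shows "of_nat p ^ lam dvd of_nat (card {c \<in> PiE {..n} (\<lambda>_. {..<N}). residue (ev n c F) = 0})
    - of_nat N ^ Suc n * (\<Sum>s<lam + tau. of_int (alpha_coeff lam tau s)
        * trace_A_pow n p g (F ^ s) m (d * s))"
proof (rule J_const)
  define C where "C = PiE {..n} (\<lambda>_. {..<N})"
  define P where "P s = (\<Prod>i<m. (frob_mpoly p phi ^^ i) (F ^ s) ^ (p - 1))" for s
  have finC: "finite C" by (simp add: C_def finite_PiE)
  \<comment> \<open>The degree of \<open>P s\<close> is
    \<open>d * s * (p - 1) * (1 + p + ... + p^(m-1))\<close>, an exact multiple of \<open>N\<close>,
    so that the quotients by \<open>N\<close> of the surviving exponents run over the degree
    \<open>d * s\<close>.\<close>
  have deg: "(\<Sum>i<m. p ^ i * (d * s) * (p - 1)) = N * (d * s)" for s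
  proof -
    have "int (\<Sum>i<m. p ^ i * (d * s) * (p - 1)) = int d * int s * ((int p - 1) * (\<Sum>i<m. int p ^ i))"
      using p_gt_0 by (simp add: of_nat_diff sum_distrib_left mult_ac)
    also have "\<dots> = int (N * (d * s))"
      using power_diff_1_eq[of "int p" m] p_gt_0 by (simp add: of_nat_diff mult_ac)
    finally show ?thesis by (simp only: of_nat_eq_iff)
  qed
  have hP: "homog n (N * (d * s)) (P s)" for s
    unfolding P_def deg[symmetric]
    by (intro homog_prod homog_power homog_frob_mpoly_funpow assms)
  have tr: "trace_A_pow n p g (F ^ s) m (d * s)
    = (\<Sum>w\<in>Bdeg n (d * s). Poly_Mapping.lookup (P s) (scale_exp N w))" for s
    unfolding P_def by (rule trace_A_pow_eq[OF p_gt_0 phi g])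
  have of_int_cong: "Jcong lam (of_int k * f) [:of_int k * x:]" if "Jcong lam f [:x:]" for k f x
  proof -
    have "of_int k = [:of_int k :: 'w:]" by (simp add: of_int_poly)
    then have "[:of_int k * x:] = of_int k * [:x:]" by simp
    then show ?thesis using Jcong_mult[OF Jcong_refl that] by (simp only:)
  qed
  have "Jcong lam (\<Sum>c\<in>C. of_bool (residue (ev n c F) = 0))
    (\<Sum>c\<in>C. \<Sum>s<lam + tau. of_int (alpha_coeff lam tau s) * ev n c (P s))"
    unfolding P_def ev_trace_poly
    by (intro Jcong_sum Jcong_sym[OF alpha_frob_norm] assms)
  also have "(\<Sum>c\<in>C. \<Sum>s<lam + tau. of_int (alpha_coeff lam tau s) * ev n c (P s))
    = (\<Sum>s<lam + tau. of_int (alpha_coeff lam tau s) * (\<Sum>c\<in>C. ev n c (P s)))"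
    by (subst sum.swap) (simp add: sum_distrib_left)
  finally have 1: "Jcong lam (\<Sum>c\<in>C. of_bool (residue (ev n c F) = 0)) \<dots>" .
  have 2: "Jcong lam (\<Sum>s<lam + tau. of_int (alpha_coeff lam tau s) * (\<Sum>c\<in>C. ev n c (P s)))
    (\<Sum>s<lam + tau. [:of_int (alpha_coeff lam tau s) * (of_nat N ^ Suc n
        * trace_A_pow n p g (F ^ s) m (d * s)):])"
    unfolding C_def tr by (intro Jcong_sum of_int_cong sum_ev hP)
  have 3: "(\<Sum>s<lam + tau. [:of_int (alpha_coeff lam tau s) * (of_nat N ^ Suc n
        * trace_A_pow n p g (F ^ s) m (d * s)):])
    = [:of_nat N ^ Suc n * (\<Sum>s<lam + tau. of_int (alpha_coeff lam tau s)
        * trace_A_pow n p g (F ^ s) m (d * s)):]"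
    unfolding is_ring_hom_sum[OF is_ring_hom_const_poly, symmetric]
    by (simp only: sum_distrib_left mult_ac)
  have 4: "(\<Sum>c\<in>C. of_bool (residue (ev n c F) = 0))
    = [:of_nat (card {c \<in> C. residue (ev n c F) = 0}) :: 'w:]"
    using finC by (simp add: of_bool_def sum.If_cases Int_def of_nat_poly)
  have "Jcong lam [:of_nat (card {c \<in> C. residue (ev n c F) = 0}):]
    [:of_nat N ^ Suc n * (\<Sum>s<lam + tau. of_int (alpha_coeff lam tau s)
        * trace_A_pow n p g (F ^ s) m (d * s)):]"
    using Jcong_trans[OF 1 2] unfolding 3 4 .
  then show "J lam [:of_nat (card {c \<in> PiE {..n} (\<lambda>_. {..<N}). residue (ev n c F) = 0})
    - of_nat N ^ Suc n * (\<Sum>s<lam + tau. of_int (alpha_coeff lam tau s)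
        * trace_A_pow n p g (F ^ s) m (d * s)):]"
    unfolding C_def Jcong_def diff_pCons diff_0 minus_zero .
qed

lemma card_zeros_eq:
  assumes "\<forall>u. red (Poly_Mapping.lookup F u) = Poly_Mapping.lookup Fbar u"
  shows "card {c \<in> PiE {..n} (\<lambda>_. UNIV - {0::'K}). eval_mpoly n e Fbar c = 0}
    = card {c \<in> PiE {..n} (\<lambda>_. {..<N}). residue (ev n c F) = 0}"
proof -
  have bij: "bij_betw (\<lambda>i. \<theta> ^ i) {..<N} (UNIV - {0})"
    using primitive_element_bij[OF theta_nz, unfolded card_K, OF theta_order] .
  have inj: "inj_on (\<lambda>i. \<theta> ^ i) {..<N}" and img: "(\<lambda>i. \<theta> ^ i) ` {..<N} = UNIV - {0}"
    using bij by (auto simp: bij_betw_def)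
  have eval: "residue (ev n c F) = eval_mpoly n e Fbar (\<lambda>i. \<theta> ^ c i)" for c
  proof -
    \<comment> \<open>The lift can have further monomials, with coefficients divisible by
      \<open>p\<close>; so \<open>Fbar\<close> is summed over the support of
      \<open>F\<close>.\<close>
    have "Poly_Mapping.keys Fbar \<subseteq> Poly_Mapping.keys F"
    proof
      fix u assume "u \<in> Poly_Mapping.keys Fbar"
      then show "u \<in> Poly_Mapping.keys F" using assms redD(4) by (metis in_keys_iff)
    qed
    then have "eval_mpoly n e Fbar (\<lambda>i. \<theta> ^ c i) = (\<Sum>u\<in>Poly_Mapping.keys F.
        e (Poly_Mapping.lookup Fbar u) * (\<Prod>i\<le>n. (\<theta> ^ c i) ^ Poly_Mapping.lookup u i))"
      by (intro eval_mpoly_superset) (simp_all add: eD)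
    then show ?thesis using assms by (simp add: residue_ev eval_mpoly_def)
  qed
  have eval_restrict: "eval_mpoly n e Fbar (restrict c {..n}) = eval_mpoly n e Fbar c" for c
    by (simp add: eval_mpoly_def)
  define h where "h c = (\<lambda>i\<in>{..n}. \<theta> ^ c i)" for c :: "nat \<Rightarrow> nat"
  have "bij_betw h {c \<in> PiE {..n} (\<lambda>_. {..<N}). residue (ev n c F) = 0}
    {c \<in> PiE {..n} (\<lambda>_. UNIV - {0::'K}). eval_mpoly n e Fbar c = 0}"
  proof (rule bij_betw_imageI)
    show "inj_on h {c \<in> PiE {..n} (\<lambda>_. {..<N}). residue (ev n c F) = 0}"
    proof (rule inj_onI)
      fix c c' assume c: "c \<in> {c \<in> PiE {..n} (\<lambda>_. {..<N}). residue (ev n c F) = 0}"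
        and c': "c' \<in> {c \<in> PiE {..n} (\<lambda>_. {..<N}). residue (ev n c F) = 0}" and eq: "h c = h c'"
      show "c = c'"
      proof (rule PiE_ext[of _ "{..n}" "\<lambda>_. {..<N}"])
        fix i assume i: "i \<in> {..n}"
        have "\<theta> ^ c i = \<theta> ^ c' i" using fun_cong[OF eq, of i] i by (simp add: h_def)
        moreover have "c i \<in> {..<N}" "c' i \<in> {..<N}" using c c' i by (simp_all add: PiE_iff)
        ultimately show "c i = c' i" by (rule inj_onD[OF inj])
      qed (use c c' in simp_all)
    qed
    show "h ` {c \<in> PiE {..n} (\<lambda>_. {..<N}). residue (ev n c F) = 0}
      = {c \<in> PiE {..n} (\<lambda>_. UNIV - {0::'K}). eval_mpoly n e Fbar c = 0}"
    proof (intro equalityI subsetI)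
      fix c assume c: "c \<in> {c \<in> PiE {..n} (\<lambda>_. UNIV - {0::'K}). eval_mpoly n e Fbar c = 0}"
      \<comment> \<open>The coordinatewise discrete logarithm to the base
        \<open>\<theta>\<close>.\<close>
      define c' where "c' = (\<lambda>i\<in>{..n}. inv_into {..<N} (\<lambda>i. \<theta> ^ i) (c i))"
      have mem: "c i \<in> (\<lambda>i. \<theta> ^ i) ` {..<N}" if "i \<le> n" for i
        using c that unfolding img by (simp add: PiE_iff)
      have "h c' = c"
      proof (rule PiE_ext[of _ "{..n}" "\<lambda>_. UNIV"])
        show "h c' \<in> PiE {..n} (\<lambda>_. UNIV)" "c \<in> PiE {..n} (\<lambda>_. UNIV)"
          using c by (auto simp: h_def PiE_def)
        show "h c' i = c i" if "i \<in> {..n}" for i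
          using that mem[of i] by (simp add: h_def c'_def f_inv_into_f)
      qed
      moreover have "c' \<in> PiE {..n} (\<lambda>_. {..<N})"
        unfolding c'_def using mem by (intro restrict_PiE_iff[THEN iffD2] ballI inv_into_into) simp
      moreover have "residue (ev n c' F) = 0"
      proof -
        have "residue (ev n c' F) = eval_mpoly n e Fbar (h c')"
          by (simp add: eval h_def eval_restrict)
        then show ?thesis using c \<open>h c' = c\<close> by simp
      qed
      ultimately show "c \<in> h ` {c \<in> PiE {..n} (\<lambda>_. {..<N}). residue (ev n c F) = 0}" by blast
    next
      fix c assume "c \<in> h ` {c \<in> PiE {..n} (\<lambda>_. {..<N}). residue (ev n c F) = 0}"
      then show "c \<in> {c \<in> PiE {..n} (\<lambda>_. UNIV - {0::'K}). eval_mpoly n e Fbar c = 0}"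
        using theta_nz by (auto simp: h_def eval eval_restrict)
    qed
  qed
  then show ?thesis by (rule bij_betw_same_card[symmetric])
qed

end

section \<open>The point count\<close>

text \<open>The division in \<open>torus_point_count\<close> is exact: nonzero scalars act freely on
  the zeros by homogeneity, and each orbit has one representative with
  \<open>c 0 = 1\<close>.\<close>

lemma torus_point_count_mult:
  fixes e :: "'k::zero \<Rightarrow> 'K::{finite,field}"
  assumes "homog n d G"
  shows "(card (UNIV :: 'K set) - 1) * torus_point_count n e G
    = card {c \<in> PiE {..n} (\<lambda>_. UNIV - {0::'K}). eval_mpoly n e G c = 0}"
proof -
  define A where "A = {c \<in> PiE {..n} (\<lambda>_. UNIV - {0::'K}). eval_mpoly n e G c = 0}"
  define A0 where "A0 = {c \<in> A. c 0 = 1}"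
  define h where "h xc = (\<lambda>i\<in>{..n}. fst xc * snd xc i)" for xc :: "'K \<times> (nat \<Rightarrow> 'K)"
  have scale: "eval_mpoly n e G (\<lambda>i\<in>{..n}. x * c i) = x ^ d * eval_mpoly n e G c" for x c
  proof -
    have "e (Poly_Mapping.lookup G u) * (\<Prod>i\<le>n. (\<lambda>i\<in>{..n}. x * c i) i ^ Poly_Mapping.lookup u i)
      = x ^ d * (e (Poly_Mapping.lookup G u) * (\<Prod>i\<le>n. c i ^ Poly_Mapping.lookup u i))"
      if "u \<in> Poly_Mapping.keys G" for u
    proof -
      have "(\<Sum>i\<le>n. Poly_Mapping.lookup u i) = d"
        using assms that by (auto simp: homog_def Bdeg_def)
      then have "(\<Prod>i\<le>n. x ^ Poly_Mapping.lookup u i) = x ^ d" by (simp flip: power_sum)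
      then show ?thesis by (simp add: power_mult_distrib prod.distrib mult_ac)
    qed
    then show ?thesis unfolding eval_mpoly_def sum_distrib_left by (intro sum.cong refl)
  qed
  have "bij_betw h ((UNIV - {0::'K}) \<times> A0) A"
  proof (rule bij_betw_byWitness[where f' = "\<lambda>c. (c 0, \<lambda>i\<in>{..n}. inverse (c 0) * c i)"])
    show "\<forall>xc\<in>(UNIV - {0::'K}) \<times> A0. (h xc 0, \<lambda>i\<in>{..n}. inverse (h xc 0) * h xc i) = xc"
    proof
      fix xc assume xc: "xc \<in> (UNIV - {0::'K}) \<times> A0"
      obtain x c where [simp]: "xc = (x, c)" by (cases xc)
      have "x \<noteq> 0" "c 0 = 1" "\<And>i. \<not> i \<le> n \<Longrightarrow> c i = undefined"
        using xc by (auto simp: A0_def A_def PiE_iff extensional_def)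
      then show "(h xc 0, \<lambda>i\<in>{..n}. inverse (h xc 0) * h xc i) = xc"
        by (auto simp: h_def fun_eq_iff)
    qed
    show "\<forall>c\<in>A. h (c 0, \<lambda>i\<in>{..n}. inverse (c 0) * c i) = c"
    proof
      fix c assume c: "c \<in> A"
      then have "c 0 \<noteq> 0" "\<And>i. \<not> i \<le> n \<Longrightarrow> c i = undefined"
        by (auto simp: A_def PiE_iff extensional_def)
      then show "h (c 0, \<lambda>i\<in>{..n}. inverse (c 0) * c i) = c"
        by (auto simp: h_def fun_eq_iff)
    qed
    show "h ` ((UNIV - {0::'K}) \<times> A0) \<subseteq> A"
      by (auto simp: h_def A0_def A_def scale)
    show "(\<lambda>c. (c 0, \<lambda>i\<in>{..n}. inverse (c 0) * c i)) ` A \<subseteq> (UNIV - {0::'K}) \<times> A0"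
      by (auto simp: A0_def A_def scale PiE_iff)
  qed
  then have "card A = card ((UNIV - {0::'K}) \<times> A0)" by (rule bij_betw_same_card[symmetric])
  also have "\<dots> = (card (UNIV :: 'K set) - 1) * card A0"
    by (simp add: card_cartesian_product)
  finally have "(card (UNIV :: 'K set) - 1) dvd card A" by simp
  then show ?thesis by (simp add: torus_point_count_def A_def)
qed

text \<open>A Bezout relation between the integers \<open>k\<close> and \<open>l\<close> maps to any
  commutative ring, so \<open>k\<close> is invertible modulo \<open>l\<close> there.\<close>

lemma dvd_cancel_of_nat_coprime:
  fixes x :: "'a::comm_ring_1"
  assumes "coprime k l" "of_nat l dvd of_nat k * x"
  shows "of_nat l dvd x"
proof -
  obtain u v where "u * int k + v * int l = gcd (int k) (int l)"
    using bezout_int by blast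
  then have uv: "u * int k + v * int l = 1"
    using assms(1) by simp
  have "x = of_int (u * int k + v * int l) * x" by (simp add: uv)
  also have "\<dots> = of_int u * (of_nat k * x) + of_nat l * (of_int v * x)"
    by (simp add: algebra_simps)
  finally have x: "x = \<dots>" .
  show ?thesis by (subst x) (intro dvd_add dvd_mult dvd_triv_left assms(2))
qed

theorem theorem3p1:
  fixes p a q n d r lam tau :: nat
    and red :: "'w::comm_ring_1 \<Rightarrow> 'k::{finite,field}"
    and phi :: "'w \<Rightarrow> 'w"
    and e :: "'k \<Rightarrow> 'K::{finite,field}"
    and Fbar :: "'k mpoly" and F :: "'w mpoly"
  assumes "prime p" and "a \<ge> 1" and "q = p ^ a" and "n \<ge> 1" and "d \<ge> 1"
    and "card (UNIV :: 'k set) = q"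
    and "is_witt_ring p red"
    and "is_frobenius_lift p red phi"
    and "r \<ge> 1" and "lam \<ge> 1" and "tau \<ge> 1"
    and "real tau \<ge> real lam / (real (p - 1) * real a * real r)"
    and "card (UNIV :: 'K set) = q ^ r" and "is_ring_hom e"
    and "homog n d Fbar"
    and "homog n d F"
    and "\<forall>u. red (Poly_Mapping.lookup F u) = Poly_Mapping.lookup Fbar u"
  shows "cong_ideal (of_nat p ^ lam)
           (of_nat (torus_point_count n e Fbar))
           (of_nat (q ^ r - 1) ^ n *
              (\<Sum>s<lam + tau. of_int (alpha_coeff lam tau s) *
                 trace_A_pow n p (inv phi) (F ^ s) (a * r) (d * s)))"
proof -
  have p: "p > 0" "p - 1 > 0" using prime_gt_1_nat[OF assms(1)] by auto
  have qr: "q ^ r = p ^ (a * r)" by (simp add: assms(3) power_mult)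
  have card_K: "card (UNIV :: 'K set) = p ^ (a * r)" using assms(13) qr by simp
  obtain \<theta> :: 'K where \<theta>: "\<theta> \<noteq> 0" "\<And>k. \<theta> ^ k = 1 \<longleftrightarrow> (card (UNIV :: 'K set) - 1) dvd k"
    using finite_field_primitive_element by metis
  interpret torus_points p "a * r" red phi e \<theta>
    using assms(1,7,8,14) card_K \<theta> by unfold_locales simp_all
  have hom: "is_ring_hom phi" and bij: "bij phi"
    using assms(8) by (auto simp: is_frobenius_lift_def)
  have "real lam \<le> real tau * (real (p - 1) * real a * real r)"
    using assms(12) p(2) assms(2,9) by (subst (asm) pos_divide_le_eq) auto
  then have "real lam \<le> real (a * r * (p - 1) * tau)"
    by (simp only: of_nat_mult mult_ac)
  then have lam: "lam \<le> a * r * (p - 1) * tau" by (simp only: of_nat_le_iff)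
  define S where "S = (\<Sum>s<lam + tau. of_int (alpha_coeff lam tau s) *
      trace_A_pow n p (inv phi) (F ^ s) (a * r) (d * s))"
  have "of_nat p ^ lam dvd of_nat (card {c \<in> PiE {..n} (\<lambda>_. {..<N}). residue (ev n c F) = 0})
      - of_nat N ^ Suc n * S"
    unfolding S_def
  proof (rule card_zeros_cong[OF assms(16,11) lam])
    show "is_ring_hom (inv phi)" using hom bij by (rule is_ring_hom_inv)
    show "inv phi (phi x) = x" for x using bij by (simp add: bij_is_inj)
    show "(inv phi ^^ (a * r)) x = x" for x
      using assms(3,6) by (intro inv_frobenius_lift_funpow_eq[OF assms(7,8) p(1) assms(2)]) simp
  qed
  also have "card {c \<in> PiE {..n} (\<lambda>_. {..<N}). residue (ev n c F) = 0} = N * torus_point_count n e Fbar"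
    using torus_point_count_mult[OF assms(15), of e] card_zeros_eq[OF assms(17), of n] card_K by simp
  also have "of_nat (N * torus_point_count n e Fbar) - of_nat N ^ Suc n * S
      = of_nat N * (of_nat (torus_point_count n e Fbar) - of_nat N ^ n * S)"
    by (simp only: of_nat_mult power_Suc right_diff_distrib mult.assoc)
  finally have dvd: "of_nat (p ^ lam) dvd of_nat N * (of_nat (torus_point_count n e Fbar) - of_nat N ^ n * S)"
    by simp
  \<comment> \<open>The zeros were counted in affine coordinates, which gives one factor
    \<open>N\<close> more than the projective count; it can be cancelled because \<open>N\<close> is
    \<open>- 1\<close> modulo \<open>p\<close>.\<close>
  have "coprime N (p ^ lam)"
  proof -
    have "coprime N (p ^ (a * r))" using p(1) by (intro coprime_diff_one_left_nat) simp
    then show ?thesis using m_gt_0 by (simp add: coprime_power_right_iff)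
  qed
  then have "of_nat (p ^ lam) dvd of_nat (torus_point_count n e Fbar) - of_nat N ^ n * S"
    using dvd by (rule dvd_cancel_of_nat_coprime)
  then show ?thesis by (simp add: cong_ideal_iff_dvd S_def qr)
qed

end
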